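(* Let $\Gamma_2=(V,L)$ be the Cayley tree of order two, with $V$ identified with the group $G_2$ (the free product of three cyclic groups of order two). Let $\xi_1:[0,1]^3\to\mathbb{R}$, $\xi_2,\xi_3:[0,1]^2\to\mathbb{R}$ be bounded measurable functions, $\beta>0$, $J,J_1,J_3,\alpha\in\mathbb{R}$ with $J_3^2+J_1^2+J^2+\alpha^2\ne0$, and $$K(t,u,v)=\exp\left\{J_3\beta\,\xi_1(t,u,v)+J\beta\,\xi_2(u,v)+J_1\beta\left(\xi_3(t,u)+\xi_3(t,v)\right)+\alpha\beta(u+v)\right\}.$$ Suppose that there exist continuous functions $\vartheta_1,\vartheta_2:[0,1]^2\to(0,\infty)$ such that $K(t,u,v)=\vartheta_1(t,u)\,\vartheta_2(t,v)$ for all $t,u,v\in[0,1]$. Let $G^\ast$ be a normal subgroup of finite index in $G_2$. Then each $G^\ast$-periodic (splitting) Gibbs measure for the model is either translation-invariant or $G_2^{(2)}$-periodic.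
   Context: The Cayley tree $\Gamma_2=(V,L)$ of order two is the infinite tree in which every vertex has exactly 3 neighbours. Let $G_2$ be the free product of three cyclic groups of order two with generators $a_1,a_2,a_3$; $V$ is identified with $G_2$ so that the neighbours of $x\in G_2$ are $xa_1,xa_2,xa_3$, and the root $x^0$ is the identity. $G_2^{(2)}$ is the subgroup of $G_2$ of elements of even word length. $d$ is the graph distance, $W_n=\{x: d(x,x^0)=n\}$, $V_n=\{x: d(x,x^0)\le n\}$, and for $x\in W_n$, $S(x)=\{y\in W_{n+1}: d(x,y)=1\}$ is the set of direct successors. For each $x$ a linear order $<$ on $S(x)$ is fixed. For $\sigma\in[0,1]^{V_n}$, $n\ge1$, the Hamiltonian on $V_n$ is $$H(\sigma)=-J_3\sum_{x\in V_{n-1}}\ \sum_{y<z,\ y,z\in S(x)}\xi_1(\sigma(x),\sigma(y),\sigma(z))-J\sum_{x\in V_{n-1}}\ \sum_{y<z,\ y,z\in S(x)}\xi_2(\sigma(y),\sigma(z))$$ $$-J_1\sum_{x\in V_{n-1}}\sum_{y\in S(x)}\xi_3(\sigma(x),\sigma(y))-\alpha\sum_{x\in V_n}\sigma(x).$$ Let $h:[0,1]\times(V\setminus\{x^0\})\to\mathbb{R}$, $(t,x)\mapsto h_{t,x}$, be measurable and bounded in $t$ for each $x$, and write $h_x=h_{\cdot,x}$. For $n\ge1$ let $\mu^{(n)}$ be the probability density on $[0,1]^{V_n}$ with respect to product Lebesgue measure given by $\mu^{(n)}(\sigma_n)=Z_n^{-1}\exp(-\beta H(\sigma_n)+\sum_{x\in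 W_n}h_{\sigma_n(x),x})$, $Z_n$ the normalizing constant. The densities are compatible if for all $n\ge2$ and $\sigma_{n-1}\in[0,1]^{V_{n-1}}$, $\int_{[0,1]^{W_n}}\mu^{(n)}(\sigma_{n-1}\vee\omega_n)\,\lambda_{W_n}(d\omega_n)=\mu^{(n-1)}(\sigma_{n-1})$, where $\lambda_{W_n}$ is product Lebesgue measure and $\vee$ is concatenation. If they are compatible, the unique probability measure $\mu$ on $[0,1]^V$ whose marginal on $[0,1]^{V_n}$ has density $\mu^{(n)}$ for all $n\ge1$ is called the splitting Gibbs measure corresponding to $h$; these are the Gibbs measures of the model. For a subgroup $G^\ast$ of $G_2$, the function $h$ is called $G^\ast$-periodic if $h_{yx}=h_x$ for all $x\in G_2$, $y\in G^\ast$ (whenever both sides are defined), and translation-invariant if it is $G_2$-periodic. A Gibbs measure is called $G^\ast$-periodic (respectively translation-invariant) if it corresponds to a $G^\ast$-periodic (respectively translation-invariant) function $h$.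
   Formalization: The fixed orders on S(x) are assumed to be restrictions of linear orders on the three neighbours of x that are invariant under left translation by G* (e.g. xa_1<xa_2<xa_3); for arbitrary orders, such as cyclic ones on pairs, the claim is false. *)

theory Defs
  imports "HOL-Probability.Probability" "HOL-Algebra.Coset"
begin

section \<open>The group $G_2$ and the Cayley tree of order two\<close>

datatype gen = A1 | A2 | A3

text \<open>
  The free product of three groups of order two is realised on reduced words: words in the
  generators without two equal adjacent letters. Multiplication is concatenation
  followed by cancellation of adjacent equal letters.
\<close>

type_synonym vertex = "gen list"

fun gcons :: "gen \<Rightarrow> vertex \<Rightarrow> vertex" where
  "gcons a [] = [a]"
| "gcons a (b # w) = (if a = b then w else a # b # w)"

definition G2 :: "vertex monoid" where
  "G2 = \<lparr>carrier = {w. distinct_adj w}, mult = foldr gcons, one = []\<rparr>"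

definition G2_even :: "vertex set" where
  "G2_even = {w \<in> carrier G2. even (length w)}"

lemma distinct_adj_gcons: "distinct_adj w \<Longrightarrow> distinct_adj (gcons a w)"
  by (cases w) (auto simp: distinct_adj_Cons)

lemma distinct_adj_foldr_gcons: "distinct_adj w \<Longrightarrow> distinct_adj (foldr gcons v w)"
  by (induction v) (auto intro: distinct_adj_gcons)

lemma gcons_gcons: "distinct_adj w \<Longrightarrow> gcons a (gcons a w) = w"
  by (cases w rule: remdups_adj.cases) (auto simp: distinct_adj_Cons)

lemma foldr_gcons_gcons:
  "distinct_adj z \<Longrightarrow> foldr gcons (gcons a w) z = gcons a (foldr gcons w z)"
  by (cases w) (auto simp: gcons_gcons distinct_adj_foldr_gcons)

lemma foldr_gcons_assoc:
  "distinct_adj z \<Longrightarrow> foldr gcons (foldr gcons x y) z = foldr gcons x (foldr gcons y z)"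
  by (induction x) (auto simp: foldr_gcons_gcons)

lemma foldr_gcons_Nil: "distinct_adj w \<Longrightarrow> foldr gcons w [] = w"
proof (induction w)
  case (Cons a w)
  then show ?case by (cases w) (auto simp: distinct_adj_Cons)
qed simp

lemma foldr_gcons_rev: "distinct_adj z \<Longrightarrow> foldr gcons (rev w) (foldr gcons w z) = z"
  by (induction w arbitrary: z) (auto simp: gcons_gcons distinct_adj_foldr_gcons)

lemma group_G2: "group G2"
proof (rule groupI)
  fix x assume "x \<in> carrier G2"
  then have "distinct_adj (rev x)" "foldr gcons (rev x) x = []"
    using foldr_gcons_rev[of "[]" x] by (auto simp: G2_def foldr_gcons_Nil)
  then show "\<exists>y\<in>carrier G2. y \<otimes>\<^bsub>G2\<^esub> x = \<one>\<^bsub>G2\<^esub>"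
    by (intro bexI[of _ "rev x"]) (simp_all add: G2_def)
qed (auto simp: G2_def distinct_adj_foldr_gcons foldr_gcons_assoc)

abbreviation V :: "vertex set" where "V \<equiv> carrier G2"

abbreviation root :: vertex where "root \<equiv> \<one>\<^bsub>G2\<^esub>"

definition nbrs :: "vertex \<Rightarrow> vertex set" where
  "nbrs x = range (\<lambda>a. x \<otimes>\<^bsub>G2\<^esub> [a])"

definition edges :: "(vertex \<times> vertex) set" where
  "edges = {(x, y). x \<in> V \<and> y \<in> nbrs x}"

definition gdist :: "vertex \<Rightarrow> vertex \<Rightarrow> nat" where
  "gdist x y = (LEAST n. (x, y) \<in> edges ^^ n)"

definition sphere_at :: "nat \<Rightarrow> vertex set" where
  "sphere_at n = {x \<in> V. gdist x root = n}"

definition ball_at :: "nat \<Rightarrow> vertex set" where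
  "ball_at n = {x \<in> V. gdist x root \<le> n}"

definition succs :: "vertex \<Rightarrow> vertex set" where
  "succs x = {y \<in> sphere_at (Suc (gdist x root)). gdist x y = 1}"


section \<open>The model\<close>

text \<open>
  The component \<open>sless M x\<close> is the set of pairs \<open>(y, z)\<close> with \<open>y < z\<close> in the linear order fixed
  at \<open>x\<close>. The Hamiltonian only uses its restriction to \<open>succs x\<close>.
\<close>

record model =
  xi1 :: "real \<Rightarrow> real \<Rightarrow> real \<Rightarrow> real"
  xi2 :: "real \<Rightarrow> real \<Rightarrow> real"
  xi3 :: "real \<Rightarrow> real \<Rightarrow> real"
  cJ3 :: real
  cJ :: real
  cJ1 :: real
  calpha :: real
  cbeta :: real
  sless :: "vertex \<Rightarrow> (vertex \<times> vertex) set"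

definition pairs :: "model \<Rightarrow> vertex \<Rightarrow> (vertex \<times> vertex) set" where
  "pairs M x = {(y, z). y \<in> succs x \<and> z \<in> succs x \<and> (y, z) \<in> sless M x}"

definition hamiltonian :: "model \<Rightarrow> nat \<Rightarrow> (vertex \<Rightarrow> real) \<Rightarrow> real" where
  "hamiltonian M n \<sigma> =
     - cJ3 M * (\<Sum>x\<in>ball_at (n - 1). \<Sum>(y, z)\<in>pairs M x. xi1 M (\<sigma> x) (\<sigma> y) (\<sigma> z))
     - cJ M * (\<Sum>x\<in>ball_at (n - 1). \<Sum>(y, z)\<in>pairs M x. xi2 M (\<sigma> y) (\<sigma> z))
     - cJ1 M * (\<Sum>x\<in>ball_at (n - 1). \<Sum>y\<in>succs x. xi3 M (\<sigma> x) (\<sigma> y))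
     - calpha M * (\<Sum>x\<in>ball_at n. \<sigma> x)"

definition kernel_K :: "model \<Rightarrow> real \<Rightarrow> real \<Rightarrow> real \<Rightarrow> real" where
  "kernel_K M t u v =
     exp (cJ3 M * cbeta M * xi1 M t u v + cJ M * cbeta M * xi2 M u v
          + cJ1 M * cbeta M * (xi3 M t u + xi3 M t v) + calpha M * cbeta M * (u + v))"


section \<open>Splitting Gibbs measures\<close>

definition unit_lborel :: "real measure" where
  "unit_lborel = restrict_space lborel {0..1}"

abbreviation lambda_on :: "vertex set \<Rightarrow> (vertex \<Rightarrow> real) measure" where
  "lambda_on A \<equiv> PiM A (\<lambda>_. unit_lborel)"

definition boundary_field :: "(real \<Rightarrow> vertex \<Rightarrow> real) \<Rightarrow> bool" where
  "boundary_field h \<longleftrightarrow> (\<forall>x\<in>V - {root}.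
     (\<lambda>t. h t x) \<in> borel_measurable (restrict_space borel {0..1}) \<and>
     bounded ((\<lambda>t. h t x) ` {0..1}))"

definition weight :: "model \<Rightarrow> (real \<Rightarrow> vertex \<Rightarrow> real) \<Rightarrow> nat \<Rightarrow> (vertex \<Rightarrow> real) \<Rightarrow> real" where
  "weight M h n \<sigma> = exp (- cbeta M * hamiltonian M n \<sigma> + (\<Sum>x\<in>sphere_at n. h (\<sigma> x) x))"

definition partition_Z :: "model \<Rightarrow> (real \<Rightarrow> vertex \<Rightarrow> real) \<Rightarrow> nat \<Rightarrow> real" where
  "partition_Z M h n = (\<integral>\<sigma>. weight M h n \<sigma> \<partial>lambda_on (ball_at n))"

definition gibbs_density ::
  "model \<Rightarrow> (real \<Rightarrow> vertex \<Rightarrow> real) \<Rightarrow> nat \<Rightarrow> (vertex \<Rightarrow> real) \<Rightarrow> real" where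
  "gibbs_density M h n \<sigma> = weight M h n \<sigma> / partition_Z M h n"

definition compatible :: "model \<Rightarrow> (real \<Rightarrow> vertex \<Rightarrow> real) \<Rightarrow> bool" where
  "compatible M h \<longleftrightarrow> (\<forall>n\<ge>2. \<forall>\<sigma>\<in>ball_at (n - 1) \<rightarrow>\<^sub>E {0..1}.
     (\<integral>\<omega>. gibbs_density M h n (merge (ball_at (n - 1)) (sphere_at n) (\<sigma>, \<omega>))
        \<partial>lambda_on (sphere_at n))
     = gibbs_density M h (n - 1) \<sigma>)"

definition splitting_gibbs ::
  "model \<Rightarrow> (real \<Rightarrow> vertex \<Rightarrow> real) \<Rightarrow> (vertex \<Rightarrow> real) measure \<Rightarrow> bool" where
  "splitting_gibbs M h \<mu> \<longleftrightarrow>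
     boundary_field h \<and> compatible M h \<and>
     prob_space \<mu> \<and> sets \<mu> = sets (lambda_on V) \<and>
     (\<forall>n\<ge>1. distr \<mu> (lambda_on (ball_at n)) (\<lambda>\<sigma>. restrict \<sigma> (ball_at n))
            = density (lambda_on (ball_at n)) (\<lambda>\<sigma>. ennreal (gibbs_density M h n \<sigma>)))"

definition periodic_field :: "vertex set \<Rightarrow> (real \<Rightarrow> vertex \<Rightarrow> real) \<Rightarrow> bool" where
  "periodic_field H h \<longleftrightarrow> (\<forall>x\<in>V. \<forall>y\<in>H. x \<noteq> root \<longrightarrow> y \<otimes>\<^bsub>G2\<^esub> x \<noteq> root \<longrightarrow>
     (\<forall>t\<in>{0..1}. h t (y \<otimes>\<^bsub>G2\<^esub> x) = h t x))"

definition periodic_gibbs :: "model \<Rightarrow> vertex set \<Rightarrow> (vertex \<Rightarrow> real) measure \<Rightarrow> bool" where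
  "periodic_gibbs M H \<mu> \<longleftrightarrow> (\<exists>h. splitting_gibbs M h \<mu> \<and> periodic_field H h)"

abbreviation translation_invariant_gibbs :: "model \<Rightarrow> (vertex \<Rightarrow> real) measure \<Rightarrow> bool" where
  "translation_invariant_gibbs M \<equiv> periodic_gibbs M (carrier G2)"


section \<open>The linear orders on the successors\<close>

text \<open>
  A linear order on \<open>succs x\<close> always extends to one on the neighbours of \<open>x\<close>, so ordering the
  three neighbours of \<open>x\<close> costs no generality. The invariance says that the rule that orders the
  neighbours is unchanged by translations from \<open>H\<close>; the standard choice, in which
  \<open>xa\<^sub>i < xa\<^sub>j\<close> iff \<open>i < j\<close>, satisfies it for every \<open>H\<close>. It cannot be dropped: if the pairs
  of successors are ordered cyclically (\<open>xa\<^sub>1 < xa\<^sub>2\<close>, \<open>xa\<^sub>2 < xa\<^sub>3\<close>,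
  \<open>xa\<^sub>3 < xa\<^sub>1\<close>, whichever pair occurs), there are models with periodic Gibbs measures
  of other periods.
\<close>

definition neighbour_orders :: "model \<Rightarrow> bool" where
  "neighbour_orders M \<longleftrightarrow> (\<forall>x\<in>V. strict_linear_order_on (nbrs x) (sless M x))"

definition invariant_orders :: "vertex set \<Rightarrow> model \<Rightarrow> bool" where
  "invariant_orders H M \<longleftrightarrow> (\<forall>g\<in>H. \<forall>x\<in>V. \<forall>y\<in>nbrs x. \<forall>z\<in>nbrs x.
     (g \<otimes>\<^bsub>G2\<^esub> y, g \<otimes>\<^bsub>G2\<^esub> z) \<in> sless M (g \<otimes>\<^bsub>G2\<^esub> x) \<longleftrightarrow> (y, z) \<in> sless M x)"

end

theory Submission
  imports Defs
begin

text \<open>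
  Write \<open>f\<^sub>x = exp h\<^sub>x\<close> and \<open>T\<^sub>i g (t) = \<integral> \<theta>\<^sub>i(t,u) g(u) du\<close>, and let \<open>\<propto>\<close> be equality up to a
  positive factor. Compatibility says \<open>f\<^sub>x \<propto> T\<^sub>1 f\<^sub>y \<cdot> T\<^sub>2 f\<^sub>z\<close> for the successors \<open>y < z\<close> of \<open>x\<close>.
  Since every coset of a finite-index normal subgroup contains words ending in any given letter,
  periodicity extends this law to every pair \<open>y < z\<close> of neighbours of \<open>x\<close>. With the middle
  neighbour \<open>m(x)\<close> and \<open>F g = T\<^sub>1 g \<cdot> T\<^sub>2 g\<close> one gets \<open>f\<^sub>x \<propto> F f\<^bsub>m(x)\<^esub>\<close>, and for each neighbour \<open>y\<close> one
  of \<open>T\<^sub>1\<close>, \<open>T\<^sub>2\<close> does not distinguish \<open>f\<^sub>y\<close> from \<open>f\<^bsub>m(x)\<^esub>\<close>. The map \<open>F\<close> itself need not contract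
  Hilbert's projective metric, but it does so strictly on pairs that one of \<open>T\<^sub>1\<close>, \<open>T\<^sub>2\<close> does not
  distinguish. As there are only finitely many \<open>f\<^sub>x\<close>, this gives first \<open>f\<^sub>x \<propto> f\<^bsub>m(m(x))\<^esub>\<close> and then
  \<open>f\<^sub>y \<propto> f\<^bsub>m(x)\<^esub>\<close> for all neighbours \<open>y\<close> of \<open>x\<close>. So \<open>f\<^sub>x\<close> depends, up to scaling, only on the parity of
  \<open>x\<close>, and normalising \<open>h\<close> to vanish at \<open>0\<close> does not change the measure.
\<close>


section \<open>Positive functions up to scaling\<close>

text \<open>Boundary fields matter only up to an additive constant at each vertex, so their
  exponentials matter only up to a positive factor.\<close>

definition prop_to :: "(real \<Rightarrow> real) \<Rightarrow> (real \<Rightarrow> real) \<Rightarrow> bool" (infix \<open>\<propto>\<close> 50) where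
  "f \<propto> g \<longleftrightarrow> (\<exists>c>0. \<forall>t\<in>{0..1}. f t = c * g t)"

definition cpos :: "(real \<Rightarrow> real) \<Rightarrow> bool" where
  "cpos g \<longleftrightarrow> continuous_on {0..1} g \<and> (\<forall>t\<in>{0..1}. 0 < g t)"

text \<open>The regularity of the exponential of a raw boundary field, which need not be continuous;
  the kernel operators improve it to \<open>cpos\<close>.\<close>

definition bpos :: "(real \<Rightarrow> real) \<Rightarrow> bool" where
  "bpos g \<longleftrightarrow> g \<in> borel_measurable unit_lborel \<and> bounded (g ` {0..1}) \<and> (\<forall>t\<in>{0..1}. 0 < g t)"

lemma prop_toI: "c > 0 \<Longrightarrow> (\<And>t. t \<in> {0..1} \<Longrightarrow> f t = c * g t) \<Longrightarrow> f \<propto> g"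
  by (auto simp: prop_to_def)

lemma prop_to_refl: "f \<propto> f"
  by (rule prop_toI[of 1]) auto

lemma prop_to_cong: "(\<And>t. t \<in> {0..1} \<Longrightarrow> f t = g t) \<Longrightarrow> f \<propto> g"
  by (rule prop_toI[of 1]) auto

lemma prop_to_sym: assumes "f \<propto> g" shows "g \<propto> f"
proof -
  obtain c where "c > 0" "\<And>t. t \<in> {0..1} \<Longrightarrow> f t = c * g t"
    using assms by (auto simp: prop_to_def)
  then show ?thesis by (intro prop_toI[of "1 / c"]) auto
qed

lemma prop_to_trans: assumes "f \<propto> g" "g \<propto> h" shows "f \<propto> h"
proof -
  obtain c d where "c > 0" "d > 0" "\<And>t. t \<in> {0..1} \<Longrightarrow> f t = c * g t"
    "\<And>t. t \<in> {0..1} \<Longrightarrow> g t = d * h t"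
    using assms by (auto simp: prop_to_def)
  then show ?thesis by (intro prop_toI[of "c * d"]) auto
qed

lemma prop_to_mult:
  assumes "f \<propto> f'" "g \<propto> g'" shows "(\<lambda>t. f t * g t) \<propto> (\<lambda>t. f' t * g' t)"
proof -
  obtain c d where "c > 0" "d > 0" "\<And>t. t \<in> {0..1} \<Longrightarrow> f t = c * f' t"
    "\<And>t. t \<in> {0..1} \<Longrightarrow> g t = d * g' t"
    using assms by (auto simp: prop_to_def)
  then show ?thesis by (intro prop_toI[of "c * d"]) auto
qed

lemma prop_to_divide:
  assumes "f \<propto> f'" "g \<propto> g'" shows "(\<lambda>t. f t / g t) \<propto> (\<lambda>t. f' t / g' t)"
proof -
  obtain c d where "c > 0" "d > 0" "\<And>t. t \<in> {0..1} \<Longrightarrow> f t = c * f' t"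
    "\<And>t. t \<in> {0..1} \<Longrightarrow> g t = d * g' t"
    using assms by (auto simp: prop_to_def)
  then show ?thesis by (intro prop_toI[of "c / d"]) auto
qed

lemma prop_to_cancel_left:
  assumes "(\<lambda>t. f t * g t) \<propto> (\<lambda>t. f t * g' t)" "cpos f" shows "g \<propto> g'"
proof -
  have "(\<lambda>t. f t * g t / f t) \<propto> (\<lambda>t. f t * g' t / f t)"
    by (rule prop_to_divide[OF assms(1) prop_to_refl])
  moreover have "f t \<noteq> 0" if "t \<in> {0..1}" for t
    using assms(2) that by (metis cpos_def less_irrefl)
  then have "g \<propto> (\<lambda>t. f t * g t / f t)" "(\<lambda>t. f t * g' t / f t) \<propto> g'"
    by (auto intro!: prop_to_cong)
  ultimately show ?thesis by (blast intro: prop_to_trans)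
qed

lemma prop_to_cancel_right:
  assumes "(\<lambda>t. f t * g t) \<propto> (\<lambda>t. f' t * g t)" "cpos g" shows "f \<propto> f'"
  using prop_to_cancel_left[of g f f'] assms by (simp add: mult.commute)

lemma cpos_mult: "cpos f \<Longrightarrow> cpos g \<Longrightarrow> cpos (\<lambda>t. f t * g t)"
  by (auto simp: cpos_def intro!: continuous_intros)

lemma cpos_divide: "cpos f \<Longrightarrow> cpos g \<Longrightarrow> cpos (\<lambda>t. f t / g t)"
  by (force simp: cpos_def intro!: continuous_intros)

lemma cpos_prop_to:
  assumes "f \<propto> g" "cpos g" shows "cpos f"
proof -
  obtain c where c: "c > 0" "\<And>t. t \<in> {0..1} \<Longrightarrow> f t = c * g t"
    using assms by (auto simp: prop_to_def)
  have "continuous_on {0..1} (\<lambda>t. c * g t)"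
    using assms(2) by (auto simp: cpos_def intro!: continuous_intros)
  then have "continuous_on {0..1} f"
    by (rule continuous_on_eq) (simp add: c)
  then show ?thesis using assms(2) c by (simp add: cpos_def)
qed

text \<open>
  \<open>osc (f / g)\<close> is the exponential of Hilbert's projective distance between \<open>f\<close> and \<open>g\<close>.
\<close>

definition osc :: "(real \<Rightarrow> real) \<Rightarrow> real" where
  "osc r = (SUP (s, t)\<in>{0..1} \<times> {0..1}. r s / r t)"

lemma osc_prop_to: assumes "r \<propto> r'" shows "osc r = osc r'"
proof -
  obtain c where "c > 0" "\<And>t. t \<in> {0..1} \<Longrightarrow> r t = c * r' t"
    using assms by (auto simp: prop_to_def)
  then show ?thesis unfolding osc_def
    by (intro SUP_cong) auto
qed

lemma osc_cong_prop_to: "f \<propto> f' \<Longrightarrow> g \<propto> g' \<Longrightarrow> osc (\<lambda>t. f t / g t) = osc (\<lambda>t. f' t / g' t)"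
  by (intro osc_prop_to prop_to_divide)

text \<open>The quotient is continuous on the compact unit square. Since its supremum is attained,
  strict pointwise bounds yield strict bounds on \<open>osc\<close>.\<close>

lemma osc_attained:
  assumes "cpos r"
  obtains s t where "s \<in> {0..1}" "t \<in> {0..1}" "osc r = r s / r t"
    and "\<And>s' t'. s' \<in> {0..1} \<Longrightarrow> t' \<in> {0..1} \<Longrightarrow> r s' / r t' \<le> osc r"
proof -
  let ?I = "{0..1::real}" and ?q = "\<lambda>p. r (fst p) / r (snd p)"
  have r: "continuous_on ?I r" "\<And>t. t \<in> ?I \<Longrightarrow> r t \<noteq> 0"
    using assms unfolding cpos_def by (auto simp: less_imp_neq[THEN not_sym])
  have "continuous_on (?I \<times> ?I) (\<lambda>p. r (fst p))" "continuous_on (?I \<times> ?I) (\<lambda>p. r (snd p))"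
    by (rule continuous_on_compose2[OF r(1)], auto intro!: continuous_intros)+
  then have "continuous_on (?I \<times> ?I) ?q"
    by (rule continuous_on_divide) (auto simp: r(2))
  then obtain p where p: "p \<in> ?I \<times> ?I" "\<And>p'. p' \<in> ?I \<times> ?I \<Longrightarrow> ?q p' \<le> ?q p"
    using continuous_attains_sup[of "?I \<times> ?I" ?q] by (auto simp: compact_Times)
  have "osc r = ?q p"
    unfolding osc_def case_prod_beta by (rule cSup_eq_maximum) (use p in auto)
  moreover have "r s' / r t' \<le> ?q p" if "s' \<in> ?I" "t' \<in> ?I" for s' t'
    using p(2)[of "(s', t')"] that by simp
  ultimately show ?thesis using p(1) that[of "fst p" "snd p"] by auto
qed


section \<open>Integral operators with positive continuous kernels\<close>

lemma space_unit_lborel: "space unit_lborel = {0..1}"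
  by (simp add: unit_lborel_def space_restrict_space)

lemma sets_unit_lborel: "sets unit_lborel = sets (restrict_space borel {0..1})"
  unfolding unit_lborel_def by (rule sets_restrict_space_cong) simp

lemma prob_space_unit_lborel: "prob_space unit_lborel"
  by (rule prob_spaceI) (simp add: space_unit_lborel, simp add: unit_lborel_def emeasure_restrict_space)

interpretation unit: prob_space unit_lborel
  by (rule prob_space_unit_lborel)

lemma borel_measurable_unit_lborel:
  "borel_measurable unit_lborel = borel_measurable (restrict_space borel {0..1})"
  by (rule measurable_cong_sets) (auto simp: sets_unit_lborel)

lemma continuous_on_measurable_unit:
  "continuous_on {0..1} g \<Longrightarrow> g \<in> borel_measurable unit_lborel"
  unfolding borel_measurable_unit_lborel by (rule borel_measurable_continuous_on_restrict)

lemma cpos_imp_bpos: "cpos g \<Longrightarrow> bpos g"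
  by (auto simp: cpos_def bpos_def intro: continuous_on_measurable_unit
      compact_imp_bounded compact_continuous_image)

lemma integral_unit_pos:
  fixes g :: "real \<Rightarrow> real"
  assumes "integrable unit_lborel g" "\<And>u. u \<in> {0..1} \<Longrightarrow> 0 < g u"
  shows "0 < (\<integral>u. g u \<partial>unit_lborel)"
proof -
  have "AE u in unit_lborel. 0 < g u"
    by (rule AE_I2) (simp add: assms(2) space_unit_lborel)
  then show ?thesis
    using unit.integral_less_AE_space[of "\<lambda>_. 0" g] assms(1) by (simp add: unit.emeasure_space_1)
qed

text \<open>Continuity spreads one nonzero value over a set of positive measure. This serves
  integrands such as \<open>c * g - f\<close> that are nonnegative but may have zeros.\<close>

lemma integral_unit_pos_continuous:
  fixes g :: "real \<Rightarrow> real"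
  assumes g: "continuous_on {0..1} g" "\<And>u. u \<in> {0..1} \<Longrightarrow> 0 \<le> g u"
    and u: "u \<in> {0..1}" "g u \<noteq> 0"
  shows "0 < (\<integral>u. g u \<partial>unit_lborel)"
proof -
  have si: "set_integrable lborel {0..1} g"
    by (rule borel_integrable_atLeastAtMost') (rule g)
  have eq: "(\<integral>u. g u \<partial>unit_lborel) = integral {0..1} g"
    using set_borel_integral_eq_integral(2)[OF si]
    by (simp add: unit_lborel_def integral_restrict_space set_lebesgue_integral_def)
  have "integral {0..1} g \<noteq> 0"
  proof
    assume "integral {0..1} g = 0"
    then have "(g has_integral 0) (cbox 0 1)"
      using integrable_continuous_interval[OF g(1)] by (metis integrable_integral box_real(2))
    then have "g u = 0"
      by (rule has_integral_0_cbox_imp_0[rotated 2]) (use g u in auto)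
    then show False using u by simp
  qed
  moreover have "0 \<le> integral {0..1} g"
    using g by (intro integral_nonneg integrable_continuous_interval) auto
  ultimately show ?thesis using eq by simp
qed

definition kernel_op :: "(real \<Rightarrow> real \<Rightarrow> real) \<Rightarrow> (real \<Rightarrow> real) \<Rightarrow> real \<Rightarrow> real" where
  "kernel_op \<theta> g t = (\<integral>u. \<theta> t u * g u \<partial>unit_lborel)"

locale pos_kernel =
  fixes \<theta> :: "real \<Rightarrow> real \<Rightarrow> real"
  assumes cont: "continuous_on ({0..1} \<times> {0..1}) (\<lambda>(t, u). \<theta> t u)"
    and pos: "\<And>t u. t \<in> {0..1} \<Longrightarrow> u \<in> {0..1} \<Longrightarrow> 0 < \<theta> t u"
begin

lemma bounded_kernel:
  obtains B where "\<And>t u. t \<in> {0..1} \<Longrightarrow> u \<in> {0..1} \<Longrightarrow> \<bar>\<theta> t u\<bar> \<le> B"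
proof -
  have "bounded ((\<lambda>(t, u). \<theta> t u) ` ({0..1} \<times> {0..1}))"
    by (intro compact_imp_bounded compact_continuous_image cont compact_Times) auto
  then show ?thesis using that by (force simp: bounded_iff)
qed

lemma continuous_right: "t \<in> {0..1} \<Longrightarrow> continuous_on {0..1} (\<theta> t)"
  using continuous_on_compose2[OF cont, of "{0..1}" "\<lambda>u. (t, u)"]
  by (force intro!: continuous_intros)

lemma continuous_left: "u \<in> {0..1} \<Longrightarrow> continuous_on {0..1} (\<lambda>t. \<theta> t u)"
  using continuous_on_compose2[OF cont, of "{0..1}" "\<lambda>t. (t, u)"]
  by (force intro!: continuous_intros)

lemma integrable_kernel:
  assumes "bpos g" "t \<in> {0..1}"
  shows "integrable unit_lborel (\<lambda>u. \<theta> t u * g u)"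
proof -
  obtain B where B: "\<And>t u. t \<in> {0..1} \<Longrightarrow> u \<in> {0..1} \<Longrightarrow> \<bar>\<theta> t u\<bar> \<le> B"
    by (rule bounded_kernel) blast
  obtain C where C: "\<And>u. u \<in> {0..1} \<Longrightarrow> \<bar>g u\<bar> \<le> C"
    using assms by (force simp: bpos_def bounded_iff)
  have "\<bar>\<theta> t u * g u\<bar> \<le> B * C" if "u \<in> {0..1}" for u
    unfolding abs_mult using B[OF assms(2) that] C[OF that] by (intro mult_mono) auto
  moreover have "(\<lambda>u. \<theta> t u * g u) \<in> borel_measurable unit_lborel"
    using assms(1) continuous_on_measurable_unit[OF continuous_right[OF assms(2)]]
    by (intro borel_measurable_times) (simp_all add: bpos_def)
  ultimately show ?thesis
    by (intro unit.integrable_const_bound[where B = "B * C"]) (auto simp: space_unit_lborel)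
qed

text \<open>Dominated convergence with a multiple of the modulus of \<open>g\<close> as majorant
  transfers the continuity of the kernel to the integral, although \<open>g\<close> is only bounded
  and measurable.\<close>

lemma cpos_kernel_op:
  assumes "bpos g" shows "cpos (kernel_op \<theta> g)"
proof -
  obtain B where B: "\<And>t u. t \<in> {0..1} \<Longrightarrow> u \<in> {0..1} \<Longrightarrow> \<bar>\<theta> t u\<bar> \<le> B"
    by (rule bounded_kernel) blast
  have "continuous_on {0..1} (kernel_op \<theta> g)"
    unfolding continuous_on_sequentially
  proof (intro allI ballI impI, elim conjE)
    fix X t assume t: "t \<in> {0..1::real}" and X: "\<forall>n. X n \<in> {0..1}" "X \<longlonglongrightarrow> t"
    have "integrable unit_lborel g"
    proof -
      obtain C where C: "\<And>u. u \<in> {0..1} \<Longrightarrow> \<bar>g u\<bar> \<le> C"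
        using assms by (force simp: bpos_def bounded_iff)
      then show ?thesis using assms
        by (intro unit.integrable_const_bound[where B = C]) (auto simp: space_unit_lborel bpos_def)
    qed
    then have "(\<lambda>n. \<integral>u. \<theta> (X n) u * g u \<partial>unit_lborel) \<longlonglongrightarrow> (\<integral>u. \<theta> t u * g u \<partial>unit_lborel)"
    proof (intro integral_dominated_convergence[where w = "\<lambda>u. B * \<bar>g u\<bar>"])
      show "AE u in unit_lborel. (\<lambda>n. \<theta> (X n) u * g u) \<longlonglongrightarrow> \<theta> t u * g u"
      proof (rule AE_I2)
        fix u assume "u \<in> space unit_lborel"
        then have "continuous_on {0..1} (\<lambda>t. \<theta> t u)"
          by (intro continuous_left) (simp add: space_unit_lborel)
        then have "(\<lambda>n. \<theta> (X n) u) \<longlonglongrightarrow> \<theta> t u"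
          using X t by (auto simp: continuous_on_sequentially comp_def)
        then show "(\<lambda>n. \<theta> (X n) u * g u) \<longlonglongrightarrow> \<theta> t u * g u"
          by (intro tendsto_intros)
      qed
      show "AE u in unit_lborel. norm (\<theta> (X n) u * g u) \<le> B * \<bar>g u\<bar>" for n
        using X B by (intro AE_I2) (auto simp: space_unit_lborel abs_mult intro!: mult_right_mono)
    qed (use assms t X integrable_kernel in \<open>auto intro: borel_measurable_integrable\<close>)
    then show "(kernel_op \<theta> g \<circ> X) \<longlonglongrightarrow> kernel_op \<theta> g t"
      by (simp add: kernel_op_def comp_def)
  qed
  moreover have "0 < kernel_op \<theta> g t" if "t \<in> {0..1}" for t
    unfolding kernel_op_def using assms pos that
    by (intro integral_unit_pos integrable_kernel) (auto simp: bpos_def)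
  ultimately show ?thesis by (simp add: cpos_def)
qed

lemma kernel_op_prop_to:
  assumes "f \<propto> g" shows "kernel_op \<theta> f \<propto> kernel_op \<theta> g"
proof -
  obtain c where c: "c > 0" "\<And>t. t \<in> {0..1} \<Longrightarrow> f t = c * g t"
    using assms by (auto simp: prop_to_def)
  have "kernel_op \<theta> f t = (\<integral>u. c * (\<theta> t u * g u) \<partial>unit_lborel)" for t
    unfolding kernel_op_def
    by (rule Bochner_Integration.integral_cong) (simp_all add: c(2) space_unit_lborel)
  then have "kernel_op \<theta> f t = c * kernel_op \<theta> g t" for t
    by (simp add: kernel_op_def)
  then show ?thesis using c by (intro prop_toI) auto
qed

text \<open>A positive kernel spreads strictness at the single point \<open>u\<close> to every
  \<open>t\<close>, since the weighted difference of the two sides is continuous, nonnegative and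
  nonzero at \<open>u\<close>.\<close>

lemma kernel_op_strict_mono:
  assumes "cpos f" "cpos g" "\<And>u. u \<in> {0..1} \<Longrightarrow> f u \<le> c * g u"
    and u: "u \<in> {0..1}" "f u \<noteq> c * g u" and t: "t \<in> {0..1}"
  shows "kernel_op \<theta> f t < c * kernel_op \<theta> g t"
proof -
  have int: "integrable unit_lborel (\<lambda>u. \<theta> t u * f u)" "integrable unit_lborel (\<lambda>u. \<theta> t u * g u)"
    using assms by (auto intro: integrable_kernel cpos_imp_bpos)
  have "0 < (\<integral>u. \<theta> t u * (c * g u - f u) \<partial>unit_lborel)"
  proof (rule integral_unit_pos_continuous[OF _ _ u(1)])
    show "continuous_on {0..1} (\<lambda>u. \<theta> t u * (c * g u - f u))"
      using assms continuous_right[OF t] by (auto simp: cpos_def intro!: continuous_intros)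
    show "0 \<le> \<theta> t v * (c * g v - f v)" if "v \<in> {0..1}" for v
      using pos[OF t that] assms(3)[OF that] by simp
    show "\<theta> t u * (c * g u - f u) \<noteq> 0"
      using pos[OF t u(1)] u(2) by simp
  qed
  also have "\<dots> = (\<integral>u. c * (\<theta> t u * g u) - \<theta> t u * f u \<partial>unit_lborel)"
    by (simp add: algebra_simps)
  also have "\<dots> = c * kernel_op \<theta> g t - kernel_op \<theta> f t"
    using int by (simp add: kernel_op_def)
  finally show ?thesis by simp
qed

text \<open>The maximum and minimum of \<open>f / g\<close> bound \<open>f\<close> by multiples of
  \<open>g\<close> from above and below. Without proportionality both bounds are strict somewhere,
  so the operator makes them strict everywhere; compactness preserves this in the
  oscillation.\<close>

lemma osc_kernel_op_less:
  assumes f: "cpos f" and g: "cpos g" and not_prop: "\<not> f \<propto> g"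
  shows "osc (\<lambda>t. kernel_op \<theta> f t / kernel_op \<theta> g t) < osc (\<lambda>t. f t / g t)"
proof -
  let ?r = "\<lambda>t. f t / g t" and ?A = "kernel_op \<theta>"
  have gp: "0 < g t" and fp: "0 < f t" if "t \<in> {0..1}" for t
    using f g that by (auto simp: cpos_def)
  have cA: "cpos (?A f)" "cpos (?A g)"
    using f g by (auto intro: cpos_kernel_op cpos_imp_bpos)
  have not_const: "\<exists>u\<in>{0..1}. f u \<noteq> c * g u" if "c > 0" for c
    using not_prop that by (auto simp: prop_to_def)
  have cr: "continuous_on {0..1} ?r"
    using cpos_divide[OF f g] by (simp add: cpos_def)
  obtain s where s: "s \<in> {0..1}" "\<And>u. u \<in> {0..1} \<Longrightarrow> ?r u \<le> ?r s"
    using continuous_attains_sup[OF _ _ cr] by auto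
  obtain t where t: "t \<in> {0..1}" "\<And>u. u \<in> {0..1} \<Longrightarrow> ?r t \<le> ?r u"
    using continuous_attains_inf[OF _ _ cr] by auto
  have rp: "0 < ?r s" "0 < ?r t" using s t gp fp by auto
  have upper: "?A f v / ?A g v < ?r s" if v: "v \<in> {0..1}" for v
  proof -
    obtain u where u: "u \<in> {0..1}" "f u \<noteq> ?r s * g u" using not_const[OF rp(1)] by blast
    have "?A f v < ?r s * ?A g v"
      by (rule kernel_op_strict_mono[OF f g _ u v]) (use s(2) gp in \<open>simp add: divide_le_eq\<close>)
    then show ?thesis using cA v by (simp add: cpos_def pos_divide_less_eq)
  qed
  have lower: "?r t < ?A f v / ?A g v" if v: "v \<in> {0..1}" for v
  proof -
    obtain u where u: "u \<in> {0..1}" "f u \<noteq> ?r t * g u" using not_const[OF rp(2)] by blast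
    \<comment> \<open>The lower bound is the upper bound for the exchanged pair, with the inverse of
      the minimum as constant.\<close>
    have "g u \<noteq> inverse (?r t) * f u"
      using u(2) rp(2) gp[OF t(1)] fp[OF t(1)] by (auto simp: field_simps)
    moreover have "g u \<le> inverse (?r t) * f u" if "u \<in> {0..1}" for u
      using t(2)[OF that] gp[OF that] gp[OF t(1)] fp[OF t(1)] by (simp add: field_simps)
    ultimately have "?A g v < inverse (?r t) * ?A f v"
      by (intro kernel_op_strict_mono[OF g f _ u(1) _ v])
    then show ?thesis using cA v rp(2) gp[OF t(1)] fp[OF t(1)] by (simp add: cpos_def field_simps)
  qed
  obtain s' t' where s': "s' \<in> {0..1}" "t' \<in> {0..1}"
      "osc (\<lambda>t. ?A f t / ?A g t) = (?A f s' / ?A g s') / (?A f t' / ?A g t')"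
    using osc_attained[OF cpos_divide[OF cA]] by metis
  note s'(3)
  also have "\<dots> < ?r s / ?r t"
  proof (rule frac_less)
    show "0 \<le> ?A f s' / ?A g s'" using cA s'(1) by (simp add: cpos_def less_imp_le)
    show "?r t \<le> ?A f t' / ?A g t'" using lower[OF s'(2)] by simp
  qed (use upper[OF s'(1)] rp in auto)
  also have "\<dots> \<le> osc ?r"
    using osc_attained[OF cpos_divide[OF f g]] s(1) t(1) by metis
  finally show ?thesis .
qed

end


section \<open>Words and neighbours\<close>

interpretation G2: group G2
  by (rule group_G2)

lemma V_iff: "x \<in> V \<longleftrightarrow> distinct_adj x"
  by (simp add: G2_def)

lemma mult_G2: "x \<otimes>\<^bsub>G2\<^esub> y = foldr gcons x y"
  by (simp add: G2_def)

lemma root_eq: "root = []"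
  by (simp add: G2_def)

lemma foldr_gcons_append: "distinct_adj (u @ v) \<Longrightarrow> foldr gcons u v = u @ v"
proof (induction u)
  case (Cons b u)
  then show ?case by (cases "u @ v") (auto simp: distinct_adj_Cons)
qed simp

text \<open>In a reduced word, a letter multiplied from the right can cancel only against the last
  one.\<close>

lemma mult_letter:
  assumes "x \<in> V"
  shows "x \<otimes>\<^bsub>G2\<^esub> [a] = (if x \<noteq> [] \<and> last x = a then butlast x else x @ [a])"
proof (cases x rule: rev_cases)
  case (snoc p b)
  then have "distinct_adj (p @ [b])" using assms by (simp add: V_iff)
  then have "distinct_adj p" "a \<noteq> b \<Longrightarrow> distinct_adj (p @ [b, a])"
    by (auto simp: distinct_adj_append_iff)
  then show ?thesis
    using foldr_gcons_append[of p "[]"] foldr_gcons_append[of p "[b, a]"] snoc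
    by (auto simp: mult_G2)
qed (simp add: mult_G2)

lemma letter_in_V: "[a] \<in> V"
  by (simp add: V_iff)

lemma nbrs_subset_V: "x \<in> V \<Longrightarrow> nbrs x \<subseteq> V"
  by (auto simp: nbrs_def intro: G2.m_closed letter_in_V)

lemma nbrs_translate:
  "g \<in> V \<Longrightarrow> x \<in> V \<Longrightarrow> y \<in> nbrs x \<Longrightarrow> g \<otimes>\<^bsub>G2\<^esub> y \<in> nbrs (g \<otimes>\<^bsub>G2\<^esub> x)"
  by (auto simp: nbrs_def G2.m_assoc letter_in_V)

lemma nbrs_sym:
  assumes "x \<in> V" "y \<in> nbrs x" shows "x \<in> nbrs y"
proof -
  obtain a where y: "y = x \<otimes>\<^bsub>G2\<^esub> [a]" using assms by (auto simp: nbrs_def)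
  have "[a] \<otimes>\<^bsub>G2\<^esub> [a] = root" by (simp add: G2_def)
  then have "x = y \<otimes>\<^bsub>G2\<^esub> [a]"
    using assms(1) by (simp add: y G2.m_assoc letter_in_V)
  then show ?thesis by (auto simp: nbrs_def)
qed

lemma UNIV_gen: "(UNIV :: gen set) = {A1, A2, A3}"
  using gen.exhaust by auto

lemma inj_mult_letter: "x \<in> V \<Longrightarrow> inj (\<lambda>a. x \<otimes>\<^bsub>G2\<^esub> [a])"
  by (auto intro!: injI simp: letter_in_V)

lemma card_nbrs: "x \<in> V \<Longrightarrow> card (nbrs x) = 3"
  unfolding nbrs_def by (simp add: card_image inj_mult_letter) (simp add: UNIV_gen)

lemma strict_linear_order_on_three:
  assumes "strict_linear_order_on A r" "card A = 3"
  obtains (sorted) l m u where "A = {l, m, u}" "(l, m) \<in> r" "(m, u) \<in> r" "(l, u) \<in> r"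
proof -
  obtain a b c where A: "A = {a, b, c}" "a \<noteq> b" "a \<noteq> c" "b \<noteq> c"
    using assms(2) by (auto simp: card_3_iff)
  have tr: "trans r" and cmp: "(a, b) \<in> r \<or> (b, a) \<in> r" "(a, c) \<in> r \<or> (c, a) \<in> r"
    "(b, c) \<in> r \<or> (c, b) \<in> r"
    using assms(1) A by (auto simp: strict_linear_order_on_def total_on_def)
  \<comment> \<open>A total relation on three points contains a chain of two steps through all of
    them, and transitivity supplies the third pair. Listing the six permutations leaves a
    propositional problem.\<close>
  have *: thesis if "A = {l, m, u}" "(l, m) \<in> r" "(m, u) \<in> r" for l m u
    using sorted[OF that] that(2,3) tr by (meson transD)
  have perm: "A = {a, b, c}" "A = {a, c, b}" "A = {b, a, c}" "A = {b, c, a}" "A = {c, a, b}" "A = {c, b, a}"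
    using A by auto
  show thesis
    using cmp *[OF perm(1)] *[OF perm(2)] *[OF perm(3)] *[OF perm(4)] *[OF perm(5)] *[OF perm(6)]
    by argo
qed


section \<open>Functions satisfying the boundary law at every pair of neighbours\<close>

text \<open>Root and parent no longer play a special part: the law holds for all ordered pairs of
  neighbours. Of periodicity only the finiteness of the range of \<open>f\<close> is kept.\<close>

locale boundary_law =
  K1: pos_kernel \<theta>1 + K2: pos_kernel \<theta>2 for \<theta>1 \<theta>2 +
  fixes M :: model and f :: "vertex \<Rightarrow> real \<Rightarrow> real"
  assumes orders: "neighbour_orders M"
    and f_cpos: "x \<in> V \<Longrightarrow> cpos (f x)"
    and f_finite: "finite (f ` V)"
    and law: "x \<in> V \<Longrightarrow> y \<in> nbrs x \<Longrightarrow> z \<in> nbrs x \<Longrightarrow> (y, z) \<in> sless M x \<Longrightarrow>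
      f x \<propto> (\<lambda>t. kernel_op \<theta>1 (f y) t * kernel_op \<theta>2 (f z) t)"
begin

abbreviation "T1 \<equiv> kernel_op \<theta>1"
abbreviation "T2 \<equiv> kernel_op \<theta>2"

section \<open>The nonlinear map and its conditional contraction\<close>

definition F :: "(real \<Rightarrow> real) \<Rightarrow> real \<Rightarrow> real" where
  "F g = (\<lambda>t. T1 g t * T2 g t)"

lemma cpos_T: "cpos g \<Longrightarrow> cpos (T1 g)" "cpos g \<Longrightarrow> cpos (T2 g)"
  by (auto intro: K1.cpos_kernel_op K2.cpos_kernel_op cpos_imp_bpos)

lemma F_prop_to: "g \<propto> h \<Longrightarrow> F g \<propto> F h"
  unfolding F_def by (intro prop_to_mult K1.kernel_op_prop_to K2.kernel_op_prop_to)

text \<open>The factor that does not distinguish \<open>g\<close> from \<open>h\<close> cancels from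
  \<open>F g / F h\<close> up to a constant; the other factor is contracted by its kernel
  operator.\<close>

lemma osc_F_less:
  assumes g: "cpos g" and h: "cpos h" and eq: "T1 g \<propto> T1 h \<or> T2 g \<propto> T2 h"
    and not_prop: "\<not> g \<propto> h"
  shows "osc (\<lambda>t. F g t / F h t) < osc (\<lambda>t. g t / h t)"
proof -
  have nz: "T1 h t \<noteq> 0" "T2 h t \<noteq> 0" if "t \<in> {0..1}" for t
    using cpos_T[OF h] that by (auto simp: cpos_def less_imp_neq[THEN not_sym])
  show ?thesis
    using eq
  proof
    assume *: "T1 g \<propto> T1 h"
    have "(\<lambda>t. F g t / F h t) \<propto> (\<lambda>t. T1 h t * T2 g t / F h t)"
      unfolding F_def by (intro prop_to_divide prop_to_mult * prop_to_refl)
    moreover have "\<dots> \<propto> (\<lambda>t. T2 g t / T2 h t)"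
      unfolding F_def using nz by (intro prop_to_cong) auto
    ultimately have "osc (\<lambda>t. F g t / F h t) = osc (\<lambda>t. T2 g t / T2 h t)"
      by (intro osc_prop_to) (rule prop_to_trans)
    then show ?thesis using K2.osc_kernel_op_less[OF g h not_prop] by simp
  next
    assume *: "T2 g \<propto> T2 h"
    have "(\<lambda>t. F g t / F h t) \<propto> (\<lambda>t. T1 g t * T2 h t / F h t)"
      unfolding F_def by (intro prop_to_divide prop_to_mult * prop_to_refl)
    moreover have "\<dots> \<propto> (\<lambda>t. T1 g t / T1 h t)"
      unfolding F_def using nz by (intro prop_to_cong) auto
    ultimately have "osc (\<lambda>t. F g t / F h t) = osc (\<lambda>t. T1 g t / T1 h t)"
      by (intro osc_prop_to) (rule prop_to_trans)
    then show ?thesis using K1.osc_kernel_op_less[OF g h not_prop] by simp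
  qed
qed

text \<open>For neighbours \<open>l < m < u\<close> three products represent \<open>f x\<close>.
  Comparing the pairs \<open>(l, u)\<close> and \<open>(l, m)\<close> cancels
  \<open>T1 (f l)\<close>; comparing \<open>(l, u)\<close> and \<open>(m, u)\<close> cancels
  \<open>T2 (f u)\<close>.\<close>

lemma middle_neighbour_exists:
  assumes "x \<in> V"
  shows "\<exists>m\<in>nbrs x. f x \<propto> F (f m) \<and>
    (\<forall>y\<in>nbrs x. T1 (f y) \<propto> T1 (f m) \<or> T2 (f y) \<propto> T2 (f m))"
proof -
  have "strict_linear_order_on (nbrs x) (sless M x)"
    using orders assms by (simp add: neighbour_orders_def)
  then obtain l m u where N: "nbrs x = {l, m, u}" and
    r: "(l, m) \<in> sless M x" "(m, u) \<in> sless M x" "(l, u) \<in> sless M x"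
    using strict_linear_order_on_three card_nbrs assms by metis
  have V: "l \<in> V" "m \<in> V" "u \<in> V" using nbrs_subset_V[OF assms] N by auto
  note c = f_cpos[OF V(1)] f_cpos[OF V(2)] f_cpos[OF V(3)]
  have lm: "f x \<propto> (\<lambda>t. T1 (f l) t * T2 (f m) t)" and mu: "f x \<propto> (\<lambda>t. T1 (f m) t * T2 (f u) t)"
    and lu: "f x \<propto> (\<lambda>t. T1 (f l) t * T2 (f u) t)"
    using law[OF assms] r N by auto
  have T2: "T2 (f u) \<propto> T2 (f m)"
    by (rule prop_to_cancel_left[OF prop_to_trans[OF prop_to_sym[OF lu] lm]]) (rule cpos_T(1)[OF c(1)])
  have T1: "T1 (f l) \<propto> T1 (f m)"
    by (rule prop_to_cancel_right[OF prop_to_trans[OF prop_to_sym[OF lu] mu]]) (rule cpos_T(2)[OF c(3)])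
  have "f x \<propto> F (f m)"
    unfolding F_def by (rule prop_to_trans[OF lm]) (intro prop_to_mult T1 prop_to_refl)
  then show ?thesis using T1 T2 N by (auto intro: prop_to_refl)
qed

definition mid :: "vertex \<Rightarrow> vertex" where
  "mid x = (SOME m. m \<in> nbrs x \<and> f x \<propto> F (f m) \<and>
    (\<forall>y\<in>nbrs x. T1 (f y) \<propto> T1 (f m) \<or> T2 (f y) \<propto> T2 (f m)))"

lemma mid:
  assumes "x \<in> V"
  shows "mid x \<in> nbrs x" "f x \<propto> F (f (mid x))"
    "y \<in> nbrs x \<Longrightarrow> T1 (f y) \<propto> T1 (f (mid x)) \<or> T2 (f y) \<propto> T2 (f (mid x))"
  using someI_ex[OF middle_neighbour_exists[OF assms, unfolded Bex_def]] unfolding mid_def by blast+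

lemma mid_in_V: "x \<in> V \<Longrightarrow> mid x \<in> V"
  using mid(1) nbrs_subset_V by blast

lemma osc_mid_less:
  assumes x: "x \<in> V" and not_prop: "\<not> f x \<propto> f (mid (mid x))"
  shows "osc (\<lambda>t. f x t / f (mid (mid x)) t) < osc (\<lambda>t. f (mid x) t / f (mid (mid (mid x))) t)"
    and "\<not> f (mid x) \<propto> f (mid (mid (mid x)))"
proof -
  let ?g = "f (mid x)" and ?h = "f (mid (mid (mid x)))"
  have V: "mid x \<in> V" "mid (mid x) \<in> V" "mid (mid (mid x)) \<in> V"
    using x by (auto intro: mid_in_V)
  have Fg: "f x \<propto> F ?g" and Fh: "f (mid (mid x)) \<propto> F ?h"
    using mid(2) x V by auto
  show "\<not> ?g \<propto> ?h"
    using not_prop prop_to_trans[OF prop_to_trans[OF Fg F_prop_to] prop_to_sym[OF Fh]] by blast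
  \<comment> \<open>By symmetry \<open>mid x\<close> is a neighbour of \<open>mid (mid x)\<close>,
    and \<open>?h\<close> belongs to the middle neighbour of that vertex.\<close>
  moreover have "T1 ?g \<propto> T1 ?h \<or> T2 ?g \<propto> T2 ?h"
    using mid(3)[OF V(2)] nbrs_sym[OF V(1)] mid(1) V by blast
  ultimately show "osc (\<lambda>t. f x t / f (mid (mid x)) t) < osc (\<lambda>t. ?g t / ?h t)"
    using osc_F_less[of ?g ?h] osc_cong_prop_to[OF Fg Fh] f_cpos V by simp
qed

text \<open>
  If the claim fails, among the finitely many pairs \<open>f x\<close>, \<open>f (mid (mid x))\<close> take one that is not
  proportional and has maximal oscillation; the pair of \<open>mid x\<close> oscillates strictly more.
\<close>

lemma mid_mid:
  assumes "x \<in> V" shows "f x \<propto> f (mid (mid x))"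
proof (rule ccontr)
  assume neg: "\<not> f x \<propto> f (mid (mid x))"
  define B where "B = {x \<in> V. \<not> f x \<propto> f (mid (mid x))}"
  define \<rho> where "\<rho> x = osc (\<lambda>t. f x t / f (mid (mid x)) t)" for x
  have "\<rho> ` B \<subseteq> (\<lambda>(g, h). osc (\<lambda>t. g t / h t)) ` (f ` V \<times> f ` V)"
    by (force simp: \<rho>_def B_def mid_in_V)
  then have "finite (\<rho> ` B)"
    by (rule finite_subset) (intro finite_imageI finite_cartesian_product f_finite)
  moreover have "\<rho> ` B \<noteq> {}" using neg assms by (auto simp: B_def)
  ultimately have "Max (\<rho> ` B) \<in> \<rho> ` B" "\<And>y. y \<in> B \<Longrightarrow> \<rho> y \<le> Max (\<rho> ` B)"
    by auto
  then obtain y where y: "y \<in> B" "\<And>z. z \<in> B \<Longrightarrow> \<rho> z \<le> \<rho> y" by auto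
  then have "mid y \<in> B" "\<rho> y < \<rho> (mid y)"
    using osc_mid_less[of y] by (auto simp: B_def \<rho>_def mid_in_V)
  then show False using y(2) by fastforce
qed

text \<open>Up to scaling, \<open>F\<close> sends the pair \<open>?w\<close>, \<open>?u\<close> to
  \<open>?v\<close>, \<open>?g\<close> and the latter back to the former. Each pair is
  undistinguished by one operator, so otherwise the oscillation would strictly decrease around a
  cycle.\<close>

lemma nbrs_prop_to_mid:
  assumes x: "x \<in> V" and y: "y \<in> nbrs x"
  shows "f y \<propto> f (mid x)"
proof (rule ccontr)
  assume neg: "\<not> f y \<propto> f (mid x)"
  have V: "y \<in> V" "mid x \<in> V" "mid y \<in> V" using x y nbrs_subset_V by (auto intro: mid_in_V)
  let ?u = "f x" and ?v = "f y" and ?g = "f (mid x)" and ?w = "f (mid y)"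
  have v: "?v \<propto> F ?w" and u: "?u \<propto> F ?g" using mid(2) x V by auto
  \<comment> \<open>\<open>mid_mid\<close> closes the cycle: up to scaling, two middle steps return
    to the starting function.\<close>
  have g: "?g \<propto> F ?u" and w: "?w \<propto> F ?v"
    by (rule prop_to_trans[OF mid(2) F_prop_to[OF prop_to_sym[OF mid_mid]]], (rule x V)+)+
  have "\<not> ?w \<propto> ?u"
    using neg prop_to_trans[OF prop_to_trans[OF v F_prop_to] prop_to_sym[OF g]] by blast
  moreover have "T1 ?w \<propto> T1 ?u \<or> T2 ?w \<propto> T2 ?u"
    using mid(3)[OF V(1) nbrs_sym[OF x y]] by (auto intro: prop_to_sym)
  ultimately have "osc (\<lambda>t. ?v t / ?g t) < osc (\<lambda>t. ?w t / ?u t)"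
    using osc_F_less[of ?w ?u] osc_cong_prop_to[OF v g] f_cpos V x by simp
  moreover have "osc (\<lambda>t. ?w t / ?u t) < osc (\<lambda>t. ?v t / ?g t)"
    using osc_F_less[of ?v ?g] osc_cong_prop_to[OF w u] f_cpos V neg mid(3)[OF x y] by simp
  ultimately show False by simp
qed

section \<open>From common neighbours to parity classes\<close>

lemma common_nbr_prop_to:
  "x \<in> V \<Longrightarrow> y \<in> nbrs x \<Longrightarrow> z \<in> nbrs x \<Longrightarrow> f y \<propto> f z"
  by (rule prop_to_trans[OF nbrs_prop_to_mid prop_to_sym[OF nbrs_prop_to_mid]])

text \<open>Deleting the last two letters leads to another neighbour of the same vertex, so
  induction reaches the root or a single letter; all single letters are neighbours of the
  root.\<close>

lemma prop_to_parity_base: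
  "x \<in> V \<Longrightarrow> f x \<propto> f (if even (length x) then [] else [A1])"
proof (induction "length x" arbitrary: x rule: less_induct)
  case less
  show ?case
  proof (cases "length x < 2")
    case True
    then consider "x = []" | a where "x = [a]" by (cases x; cases "tl x") auto
    then show ?thesis
    proof cases
      case (2 a)
      have "[b] \<in> nbrs []" for b by (auto simp: nbrs_def mult_G2)
      then show ?thesis using common_nbr_prop_to[of "[]" "[a]" "[A1]"] 2 by (simp add: V_iff)
    qed (simp add: prop_to_refl)
  next
    case False
    then obtain q b where q: "x = q @ [b]" "q \<noteq> []"
      by (cases x rule: rev_cases) auto
    then obtain p a where x: "x = p @ [a, b]"
      by (cases q rule: rev_cases) auto
    have V: "p \<in> V" "p @ [a] \<in> V" "a \<noteq> b" "p \<noteq> [] \<Longrightarrow> last p \<noteq> a"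
      using less.prems x by (auto simp: V_iff distinct_adj_append_iff)
    have "(p @ [a]) \<otimes>\<^bsub>G2\<^esub> [b] = x" "(p @ [a]) \<otimes>\<^bsub>G2\<^esub> [a] = p"
      using V x by (simp_all add: mult_letter)
    then have "x \<in> nbrs (p @ [a])" "p \<in> nbrs (p @ [a])" unfolding nbrs_def by (metis rangeI)+
    then have "f x \<propto> f p" by (rule common_nbr_prop_to[OF V(2)])
    moreover have "f p \<propto> f (if even (length p) then [] else [A1])"
      using less.hyps[OF _ V(1)] x by simp
    ultimately have "f x \<propto> f (if even (length p) then [] else [A1])"
      by (rule prop_to_trans)
    then show ?thesis using x by simp
  qed
qed

lemma prop_to_same_parity:
  assumes "x \<in> V" "y \<in> V" "even (length x) = even (length y)"
  shows "f x \<propto> f y"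
proof (rule prop_to_trans)
  show "f x \<propto> f (if even (length y) then [] else [A1])"
    using prop_to_parity_base[OF assms(1)] assms(3) by simp
qed (rule prop_to_sym[OF prop_to_parity_base[OF assms(2)]])

end


section \<open>Spheres and successors\<close>

lemma nbrs_iff:
  assumes "x \<in> V"
  shows "y \<in> nbrs x \<longleftrightarrow> y \<in> V \<and> (y \<noteq> [] \<and> butlast y = x \<or> x \<noteq> [] \<and> y = butlast x)"
proof
  assume "y \<in> nbrs x"
  then show "y \<in> V \<and> (y \<noteq> [] \<and> butlast y = x \<or> x \<noteq> [] \<and> y = butlast x)"
    using nbrs_subset_V[OF assms] by (auto simp: nbrs_def mult_letter[OF assms] split: if_splits)
next
  assume "y \<in> V \<and> (y \<noteq> [] \<and> butlast y = x \<or> x \<noteq> [] \<and> y = butlast x)"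
  then consider "y \<in> V" "y \<noteq> []" "butlast y = x" | "x \<noteq> []" "y = butlast x" by auto
  then show "y \<in> nbrs x"
  proof cases
    case 1
    then have "y = x @ [last y]" by (metis append_butlast_last_id)
    moreover from this have "x \<noteq> [] \<Longrightarrow> last x \<noteq> last y"
      using 1(1) by (metis V_iff distinct_adj_append_iff list.sel(1) list.distinct(1))
    ultimately have "y = x \<otimes>\<^bsub>G2\<^esub> [last y]"
      using assms by (auto simp: mult_letter)
    then show ?thesis by (auto simp: nbrs_def)
  next
    case 2
    then have "y = x \<otimes>\<^bsub>G2\<^esub> [last x]"
      using assms by (auto simp: mult_letter)
    then show ?thesis by (auto simp: nbrs_def)
  qed
qed

lemma butlast_in_V: "x \<in> V \<Longrightarrow> butlast x \<in> V"
  by (cases x rule: rev_cases) (auto simp: V_iff distinct_adj_append_iff)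

section \<open>Graph distance and word length\<close>

lemma edges_iff: "(x, y) \<in> edges \<longleftrightarrow> x \<in> V \<and> y \<in> nbrs x"
  by (simp add: edges_def)

text \<open>An edge changes the length by one, which bounds the distance to the root from
  below.\<close>

lemma relpow_edges_length: "(x, y) \<in> edges ^^ n \<Longrightarrow> length x \<le> length y + n"
proof (induction n arbitrary: y)
  case (Suc n)
  then obtain z where "(x, z) \<in> edges ^^ n" "z \<in> V" "y \<in> nbrs z" by (auto simp: edges_iff)
  then show ?case using Suc.IH[of z] by (auto simp: nbrs_iff)
qed simp

lemma relpow_edges_root:
  "x \<in> V \<Longrightarrow> (x, []) \<in> edges ^^ length x \<and> ([], x) \<in> edges ^^ length x"
proof (induction x rule: rev_induct)
  case (snoc a p)
  have p: "p \<in> V" using butlast_in_V[OF snoc.prems] by simp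
  have "(p @ [a], p) \<in> edges" "(p, p @ [a]) \<in> edges"
    using p snoc.prems by (auto simp: edges_iff nbrs_iff)
  then show ?case
    using snoc.IH[OF p] relpow_Suc_I2[of "p @ [a]" p edges "[]"] relpow_Suc_I[of "[]" p _ edges "p @ [a]"]
    by simp
qed simp

lemma gdist_root: "x \<in> V \<Longrightarrow> gdist x root = length x"
  unfolding gdist_def root_eq using relpow_edges_root relpow_edges_length
  by (intro Least_equality) force+

lemma gdist_eq_1:
  assumes "x \<in> V" "y \<in> V" shows "gdist x y = 1 \<longleftrightarrow> y \<in> nbrs x"
proof
  \<comment> \<open>The path through the root shows that the \<open>LEAST\<close> in
    \<open>gdist\<close> ranges over a nonempty set.\<close>
  have "(x, y) \<in> edges ^^ (length x + length y)"
    using relpow_edges_root assms by (auto simp: relpow_add)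
  then have "(x, y) \<in> edges ^^ gdist x y" unfolding gdist_def by (rule LeastI)
  then show "gdist x y = 1 \<Longrightarrow> y \<in> nbrs x" by (simp add: edges_iff)
next
  assume y: "y \<in> nbrs x"
  then have "x \<noteq> y" using assms(1) by (metis nbrs_iff append_butlast_last_id append_self_conv not_Cons_self)
  then show "gdist x y = 1"
    unfolding gdist_def using assms(1) y
    by (intro Least_equality) (auto simp: edges_iff Suc_le_eq intro!: Nat.gr0I)
qed

lemma sphere_eq: "sphere_at n = {x \<in> V. length x = n}"
  by (auto simp: sphere_at_def gdist_root)

lemma ball_eq: "ball_at n = {x \<in> V. length x \<le> n}"
  by (auto simp: ball_at_def gdist_root)

lemma finite_ball: "finite (ball_at n)"
proof (rule finite_subset)
  show "ball_at n \<subseteq> {w. set w \<subseteq> UNIV \<and> length w \<le> n}" by (auto simp: ball_eq)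
  have "finite (UNIV :: gen set)" by (simp add: UNIV_gen)
  then show "finite {w. set w \<subseteq> (UNIV :: gen set) \<and> length w \<le> n}"
    by (rule finite_lists_length_le)
qed

lemma finite_sphere: "finite (sphere_at n)"
  by (rule finite_subset[OF _ finite_ball[of n]]) (auto simp: ball_eq sphere_eq)

lemma succs_eq: "x \<in> V \<Longrightarrow> succs x = {y \<in> V. y \<noteq> [] \<and> butlast y = x}"
  by (auto simp: succs_def gdist_root gdist_eq_1[simplified] sphere_eq nbrs_iff)

lemma nbrs_eq_insert_succs: "x \<in> V \<Longrightarrow> x \<noteq> [] \<Longrightarrow> nbrs x = insert (butlast x) (succs x)"
  by (auto simp: nbrs_iff succs_eq butlast_in_V)

lemma succs_subset_nbrs: "x \<in> V \<Longrightarrow> succs x \<subseteq> nbrs x"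
  by (auto simp: nbrs_iff succs_eq)

text \<open>One of the three neighbours is the parent. The root has no parent and is therefore
  excluded.\<close>

lemma card_succs: assumes "x \<in> V" "x \<noteq> []" shows "card (succs x) = 2"
proof -
  have "butlast x \<notin> succs x"
  proof
    assume "butlast x \<in> succs x"
    then have "length (butlast (butlast x)) = length x"
      using assms(1) by (simp add: succs_eq)
    moreover have "length x > 0" using assms(2) by simp
    ultimately show False unfolding length_butlast by linarith
  qed
  moreover have "finite (succs x)"
    using card_nbrs[OF assms(1)] assms by (metis card.infinite finite_insert nbrs_eq_insert_succs zero_neq_numeral)
  ultimately show ?thesis
    using card_nbrs[OF assms(1)] nbrs_eq_insert_succs[OF assms] by simp
qed

lemma pairs_singleton:
  assumes "neighbour_orders M" "x \<in> V" "x \<noteq> []" "succs x = {y, z}" "(y, z) \<in> sless M x"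
  shows "pairs M x = {(y, z)}"
proof -
  have "trans (sless M x)" "irrefl (sless M x)"
    using assms by (auto simp: neighbour_orders_def strict_linear_order_on_def)
  then have "(z, y) \<notin> sless M x" "(y, y) \<notin> sless M x" "(z, z) \<notin> sless M x"
    using assms(5) by (auto simp: irrefl_def dest: transD)
  then show ?thesis using assms by (auto simp: pairs_def)
qed

lemma ordered_succs:
  assumes "neighbour_orders M" "x \<in> V" "x \<noteq> []"
  obtains y z where "succs x = {y, z}" "y \<noteq> z" "(y, z) \<in> sless M x"
proof -
  obtain y z where yz: "succs x = {y, z}" "y \<noteq> z"
    using card_succs[OF assms(2,3)] by (auto simp: card_2_iff)
  then have "{y, z} \<subseteq> nbrs x" using succs_subset_nbrs[OF assms(2)] by simp
  then have "(y, z) \<in> sless M x \<or> (z, y) \<in> sless M x"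
    using assms yz by (auto simp: neighbour_orders_def strict_linear_order_on_def total_on_def)
  moreover have "succs x = {z, y}" using yz by auto
  ultimately show ?thesis using that yz by metis
qed


section \<open>Cosets of a normal subgroup of finite index\<close>

text \<open>Each letter of \<open>u\<close> cancels at most one letter at the front of
  \<open>w\<close>. The length bound carries the induction: the last letter is never
  reached.\<close>

lemma foldr_gcons_last:
  "length u < length w \<Longrightarrow> foldr gcons u w \<noteq> [] \<and> last (foldr gcons u w) = last w
    \<and> length w - length u \<le> length (foldr gcons u w)"
proof (induction u)
  case (Cons c u)
  then show ?case by (cases "foldr gcons u w") (auto split: if_splits)
qed simp

text \<open>
  Some power \<open>(ab)\<^sup>k\<close> longer than \<open>x\<close> lies in the subgroup by the pigeonhole principle, and
  \<open>x (ab)\<^sup>k\<close>, which ends in \<open>b\<close>, is a left translate of \<open>x\<close> by normality.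
\<close>

lemma translate_with_last_letter:
  assumes "normal H G2" "finite (rcosets\<^bsub>G2\<^esub> H)" "x \<in> V"
  obtains g where "g \<in> H" "g \<otimes>\<^bsub>G2\<^esub> x \<noteq> []" "last (g \<otimes>\<^bsub>G2\<^esub> x) = b"
proof -
  interpret H: normal H G2 by (rule assms(1))
  obtain a where ab: "a \<noteq> b" by (metis gen.distinct(1))
  define w where "w k = concat (replicate k [a, b])" for k
  have adj: "distinct_adj (w k) \<and> (k > 0 \<longrightarrow> w k \<noteq> [] \<and> hd (w k) = a \<and> last (w k) = b)" for k
    unfolding w_def using ab by (induction k) (auto simp: distinct_adj_Cons neq_Nil_conv)
  have w_add: "w (i + j) = w i \<otimes>\<^bsub>G2\<^esub> w j" for i j
  proof -
    have "w (i + j) = w i @ w j" by (simp add: w_def replicate_add)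
    then show ?thesis using foldr_gcons_append adj by (metis mult_G2)
  qed
  have wV: "w k \<in> V" for k using adj by (simp add: V_iff)
  have len: "length (w k) = 2 * k" for k unfolding w_def by (induction k) auto
  have "(\<lambda>k. H #>\<^bsub>G2\<^esub> w k) ` UNIV \<subseteq> rcosets\<^bsub>G2\<^esub> H"
    using wV by (auto simp: RCOSETS_def)
  then have "finite ((\<lambda>k. H #>\<^bsub>G2\<^esub> w k) ` UNIV)" using assms(2) by (rule finite_subset)
  then obtain i where i: "infinite {j. H #>\<^bsub>G2\<^esub> w j = H #>\<^bsub>G2\<^esub> w i}"
    using pigeonhole_infinite[of UNIV "\<lambda>k. H #>\<^bsub>G2\<^esub> w k"] by auto
  then obtain j where j: "j > i + length x" "H #>\<^bsub>G2\<^esub> w j = H #>\<^bsub>G2\<^esub> w i"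
    by (auto simp: infinite_nat_iff_unbounded)
  define k where "k = j - i"
  have k: "k > length x" "j = k + i" using j by (auto simp: k_def)
  have "w j \<in> H #>\<^bsub>G2\<^esub> w i"
    using j(2) G2.rcos_self[OF wV H.subgroup_axioms] by metis
  then obtain h where h: "h \<in> H" "w k \<otimes>\<^bsub>G2\<^esub> w i = h \<otimes>\<^bsub>G2\<^esub> w i"
    using w_add k(2) by (auto simp: r_coset_def)
  then have wk: "w k \<in> H" using wV by (simp add: H.mem_carrier)
  let ?g = "x \<otimes>\<^bsub>G2\<^esub> w k \<otimes>\<^bsub>G2\<^esub> inv\<^bsub>G2\<^esub> x"
  have "?g \<in> H" using H.inv_op_closed2 assms(3) wk by blast
  moreover have "?g \<otimes>\<^bsub>G2\<^esub> x = x \<otimes>\<^bsub>G2\<^esub> w k"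
    using assms(3) wV by (simp add: G2.m_assoc)
  moreover have "foldr gcons x (w k) \<noteq> [] \<and> last (foldr gcons x (w k)) = b"
    using foldr_gcons_last[of x "w k"] adj[of k] len[of k] k by auto
  ultimately show ?thesis using that[of ?g] by (simp add: mult_G2)
qed


section \<open>The boundary law of compatible densities\<close>

lemma ball_Suc: "ball_at (Suc n) = ball_at n \<union> sphere_at (Suc n)" "ball_at n \<inter> sphere_at (Suc n) = {}"
  by (auto simp: ball_eq sphere_eq)

lemma sphere_Suc: "sphere_at (Suc n) = (\<Union>x\<in>sphere_at n. succs x)"
proof -
  have "y \<in> succs (butlast y) \<and> butlast y \<in> sphere_at n" if "y \<in> sphere_at (Suc n)" for y
    using that butlast_in_V[of y] by (auto simp: sphere_eq succs_eq)
  moreover have "succs x \<subseteq> sphere_at (Suc n)" if "x \<in> sphere_at n" for x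
    using that by (force simp: sphere_eq succs_eq)
  ultimately show ?thesis by blast
qed

lemma finite_succs: "x \<in> V \<Longrightarrow> finite (succs x)"
  by (rule finite_subset[OF succs_subset_nbrs]) (simp_all add: nbrs_def UNIV_gen)

lemma sum_sphere_Suc: "(\<Sum>y\<in>sphere_at (Suc n). g y) = (\<Sum>x\<in>sphere_at n. \<Sum>y\<in>succs x. g y)"
  unfolding sphere_Suc
  by (rule sum.UNION_disjoint[OF finite_sphere]) (simp add: sphere_eq finite_succs, auto simp: sphere_eq succs_eq)

lemma prod_sphere_Suc: "(\<Prod>y\<in>sphere_at (Suc n). g y) = (\<Prod>x\<in>sphere_at n. \<Prod>y\<in>succs x. g y)"
  unfolding sphere_Suc
  by (rule prod.UNION_disjoint[OF finite_sphere]) (simp add: sphere_eq finite_succs, auto simp: sphere_eq succs_eq)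

text \<open>The interaction below \<open>x\<close>, with the sign it has in the exponent. The
  external field is kept apart because its sum reaches one sphere further.\<close>

definition local_energy :: "model \<Rightarrow> vertex \<Rightarrow> (vertex \<Rightarrow> real) \<Rightarrow> real" where
  "local_energy M x \<sigma> =
     cJ3 M * (\<Sum>(y, z)\<in>pairs M x. xi1 M (\<sigma> x) (\<sigma> y) (\<sigma> z))
     + cJ M * (\<Sum>(y, z)\<in>pairs M x. xi2 M (\<sigma> y) (\<sigma> z))
     + cJ1 M * (\<Sum>y\<in>succs x. xi3 M (\<sigma> x) (\<sigma> y))"

lemma hamiltonian_eq:
  "hamiltonian M n \<sigma> = - (\<Sum>x\<in>ball_at (n - 1). local_energy M x \<sigma>) - calpha M * (\<Sum>x\<in>ball_at n. \<sigma> x)"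
  by (simp add: hamiltonian_def local_energy_def sum.distrib flip: sum_distrib_left)

lemma local_energy_cong:
  assumes "\<sigma> x = \<tau> x" "\<And>y. y \<in> succs x \<Longrightarrow> \<sigma> y = \<tau> y"
  shows "local_energy M x \<sigma> = local_energy M x \<tau>"
proof -
  have "pairs M x \<subseteq> succs x \<times> succs x" by (auto simp: pairs_def)
  then show ?thesis unfolding local_energy_def using assms
    by (intro arg_cong2[where f = "(+)"] arg_cong2[where f = "(*)"] sum.cong refl) auto
qed

lemma hamiltonian_cong:
  assumes "n \<ge> 1" "\<And>x. x \<in> ball_at n \<Longrightarrow> \<sigma> x = \<tau> x"
  shows "hamiltonian M n \<sigma> = hamiltonian M n \<tau>"
proof -
  have "x \<in> ball_at n \<and> succs x \<subseteq> ball_at n" if "x \<in> ball_at (n - 1)" for x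
    using that assms(1) by (force simp: ball_eq succs_eq)
  then have "local_energy M x \<sigma> = local_energy M x \<tau>" if "x \<in> ball_at (n - 1)" for x
    using that assms(2) by (intro local_energy_cong) blast+
  then show ?thesis unfolding hamiltonian_eq using assms(2) by simp
qed

lemma hamiltonian_Suc:
  assumes "n \<ge> 1"
  shows "hamiltonian M (Suc n) \<sigma> = hamiltonian M n \<sigma>
    - (\<Sum>x\<in>sphere_at n. local_energy M x \<sigma> + calpha M * (\<Sum>y\<in>succs x. \<sigma> y))"
proof -
  \<comment> \<open>For \<open>n = 0\<close> truncated subtraction would already count the
    interaction at the root, and the recursion would break.\<close>
  obtain m where m: "n = Suc m" using assms by (cases n) auto
  have "sum g (ball_at (Suc k)) = sum g (ball_at k) + sum g (sphere_at (Suc k))" for k and g :: "vertex \<Rightarrow> real"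
    unfolding ball_Suc(1) by (rule sum.union_disjoint[OF finite_ball finite_sphere ball_Suc(2)])
  then show ?thesis
    unfolding hamiltonian_eq by (simp add: m sum_sphere_Suc sum.distrib sum_distrib_left algebra_simps)
qed

lemma bpos_exp_field:
  assumes "boundary_field h" "x \<in> V" "x \<noteq> []"
  shows "bpos (\<lambda>t. exp (h t x))"
proof -
  have h: "(\<lambda>t. h t x) \<in> borel_measurable unit_lborel" "bounded ((\<lambda>t. h t x) ` {0..1})"
    using assms by (auto simp: boundary_field_def borel_measurable_unit_lborel root_eq)
  then obtain B where B: "\<forall>s\<in>(\<lambda>t. h t x) ` {0..1}. norm s \<le> B" by (auto simp: bounded_iff)
  have "h t x \<le> B" if "t \<in> {0..1}" for t
  proof -
    have "norm (h t x) \<le> B" using B that by blast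
    then show ?thesis by simp
  qed
  then have "bounded ((\<lambda>t. exp (h t x)) ` {0..1})"
    by (intro boundedI[of _ "exp B"]) auto
  then show ?thesis using h by (simp add: bpos_def)
qed

text \<open>The existence of the measure gives this without an integrability argument: by the
  convention for division by zero, a vanishing constant would make the density zero, which is not a
  probability density.\<close>

lemma partition_Z_pos:
  assumes "splitting_gibbs M h \<mu>" "n \<ge> 1"
  shows "0 < partition_Z M h n"
proof -
  let ?B = "lambda_on (ball_at n)"
  interpret \<mu>: prob_space \<mu> using assms by (simp add: splitting_gibbs_def)
  have sets: "sets \<mu> = sets (lambda_on V)" and
    eq: "distr \<mu> ?B (\<lambda>\<sigma>. restrict \<sigma> (ball_at n)) = density ?B (\<lambda>\<sigma>. ennreal (gibbs_density M h n \<sigma>))"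
    using assms by (auto simp: splitting_gibbs_def)
  have "(\<lambda>\<sigma>. restrict \<sigma> (ball_at n)) \<in> measurable (lambda_on V) ?B"
    by (rule measurable_restrict_subset) (auto simp: ball_eq)
  then have "(\<lambda>\<sigma>. restrict \<sigma> (ball_at n)) \<in> measurable \<mu> ?B"
    using measurable_cong_sets[OF sets refl] by blast
  then have "prob_space (density ?B (\<lambda>\<sigma>. ennreal (gibbs_density M h n \<sigma>)))"
    using \<mu>.prob_space_distr eq by metis
  then have "emeasure (density ?B (\<lambda>\<sigma>. ennreal (gibbs_density M h n \<sigma>))) (space ?B) = 1"
    using prob_space.emeasure_space_1 by force
  then have "partition_Z M h n \<noteq> 0"
    by (auto simp: gibbs_density_def emeasure_density)
  moreover have "0 \<le> partition_Z M h n"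
    unfolding partition_Z_def by (intro Bochner_Integration.integral_nonneg) (simp add: weight_def)
  ultimately show ?thesis by simp
qed

section \<open>Integrating out one sphere when the kernel factorises\<close>

interpretation unit_prod: product_sigma_finite "\<lambda>_. unit_lborel"
  by unfold_locales

locale factorized_model =
  K1: pos_kernel \<theta>1 + K2: pos_kernel \<theta>2 for \<theta>1 \<theta>2 +
  fixes M :: model
  assumes orders: "neighbour_orders M"
    and K_factor: "t \<in> {0..1} \<Longrightarrow> u \<in> {0..1} \<Longrightarrow> v \<in> {0..1} \<Longrightarrow>
      kernel_K M t u v = \<theta>1 t u * \<theta>2 t v"
begin

text \<open>Attaches to \<open>y\<close> the factor of the edge to its parent: below a non-root
  vertex, \<open>\<theta>1\<close> goes to the smaller successor and \<open>\<theta>2\<close> to the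
  larger. Products over a sphere can then be indexed by single vertices.\<close>

definition edge_kernel :: "vertex \<Rightarrow> real \<Rightarrow> real \<Rightarrow> real" where
  "edge_kernel y = (if \<exists>z. (y, z) \<in> pairs M (butlast y) then \<theta>1 else \<theta>2)"

lemma pos_kernel_edge_kernel: "pos_kernel (edge_kernel y)"
  by (simp add: edge_kernel_def K1.pos_kernel_axioms K2.pos_kernel_axioms)

text \<open>The general \<open>g\<close> covers both the kernels themselves and their integral
  operators.\<close>

lemma prod_succs:
  assumes "x \<in> V" "x \<noteq> []" "succs x = {y, z}" "y \<noteq> z" "(y, z) \<in> sless M x"
  shows "(\<Prod>w\<in>succs x. g (edge_kernel w) w) = g \<theta>1 y * (g \<theta>2 z :: real)"
proof -
  have "butlast y = x" "butlast z = x" using assms by (auto simp: succs_eq)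
  then have "edge_kernel y = \<theta>1" "edge_kernel z = \<theta>2"
    using pairs_singleton[OF orders assms(1-3,5)] assms(4) by (auto simp: edge_kernel_def)
  then show ?thesis using assms by simp
qed

text \<open>A non-root vertex has exactly one ordered pair of successors, so the exponential is a
  single value of \<open>kernel_K\<close>, which splits by assumption.\<close>

lemma exp_local_energy:
  assumes x: "x \<in> V" "x \<noteq> []" and \<sigma>: "\<sigma> x \<in> {0..1}" "\<And>y. y \<in> succs x \<Longrightarrow> \<sigma> y \<in> {0..1}"
  shows "exp (cbeta M * (local_energy M x \<sigma> + calpha M * (\<Sum>y\<in>succs x. \<sigma> y)))
    = (\<Prod>y\<in>succs x. edge_kernel y (\<sigma> x) (\<sigma> y))"
proof -
  obtain y z where yz: "succs x = {y, z}" "y \<noteq> z" "(y, z) \<in> sless M x"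
    using ordered_succs[OF orders x] .
  have "cbeta M * (local_energy M x \<sigma> + calpha M * (\<Sum>y\<in>succs x. \<sigma> y))
    = cJ3 M * cbeta M * xi1 M (\<sigma> x) (\<sigma> y) (\<sigma> z) + cJ M * cbeta M * xi2 M (\<sigma> y) (\<sigma> z)
      + cJ1 M * cbeta M * (xi3 M (\<sigma> x) (\<sigma> y) + xi3 M (\<sigma> x) (\<sigma> z)) + calpha M * cbeta M * (\<sigma> y + \<sigma> z)"
    unfolding local_energy_def pairs_singleton[OF orders x yz(1,3)] using yz(1,2)
    by (simp add: algebra_simps)
  then have "exp (cbeta M * (local_energy M x \<sigma> + calpha M * (\<Sum>y\<in>succs x. \<sigma> y)))
    = kernel_K M (\<sigma> x) (\<sigma> y) (\<sigma> z)"
    by (simp only: kernel_K_def)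
  also have "\<dots> = \<theta>1 (\<sigma> x) (\<sigma> y) * \<theta>2 (\<sigma> x) (\<sigma> z)"
    using \<sigma> yz(1) by (intro K_factor) auto
  also have "\<dots> = (\<Prod>y\<in>succs x. edge_kernel y (\<sigma> x) (\<sigma> y))"
    using prod_succs[OF x yz, of "\<lambda>k w. k (\<sigma> x) (\<sigma> w)"] by simp
  finally show ?thesis .
qed

lemma weight_Suc:
  assumes n: "n \<ge> 1" and \<sigma>: "\<And>x. x \<in> ball_at (Suc n) \<Longrightarrow> \<sigma> x \<in> {0..1}"
  shows "weight M h (Suc n) \<sigma> = exp (- cbeta M * hamiltonian M n \<sigma>) *
    (\<Prod>y\<in>sphere_at (Suc n). edge_kernel y (\<sigma> (butlast y)) (\<sigma> y) * exp (h (\<sigma> y) y))"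
proof -
  have distrib: "- c * (a - sum g S) = - c * a + (\<Sum>x\<in>S. c * g x)" for c a :: real and g and S :: "vertex set"
    unfolding sum_distrib_left[symmetric] by (simp add: algebra_simps)
  have "exp (- cbeta M * hamiltonian M (Suc n) \<sigma>) = exp (- cbeta M * hamiltonian M n \<sigma>) *
    (\<Prod>x\<in>sphere_at n. exp (cbeta M * (local_energy M x \<sigma> + calpha M * (\<Sum>y\<in>succs x. \<sigma> y))))"
    unfolding hamiltonian_Suc[OF n] exp_sum[OF finite_sphere, symmetric] exp_add[symmetric] distrib ..
  also have "(\<Prod>x\<in>sphere_at n. exp (cbeta M * (local_energy M x \<sigma> + calpha M * (\<Sum>y\<in>succs x. \<sigma> y))))
    = (\<Prod>x\<in>sphere_at n. \<Prod>y\<in>succs x. edge_kernel y (\<sigma> (butlast y)) (\<sigma> y))"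
  proof (rule prod.cong[OF refl])
    fix x assume x: "x \<in> sphere_at n"
    then have xV: "x \<in> V" "x \<noteq> []" using n by (auto simp: sphere_eq)
    have "exp (cbeta M * (local_energy M x \<sigma> + calpha M * (\<Sum>y\<in>succs x. \<sigma> y)))
      = (\<Prod>y\<in>succs x. edge_kernel y (\<sigma> x) (\<sigma> y))"
      using x \<sigma> by (intro exp_local_energy xV) (force simp: ball_eq sphere_eq succs_eq)+
    also have "\<dots> = (\<Prod>y\<in>succs x. edge_kernel y (\<sigma> (butlast y)) (\<sigma> y))"
      using xV by (intro prod.cong) (auto simp: succs_eq)
    finally show "exp (cbeta M * (local_energy M x \<sigma> + calpha M * (\<Sum>y\<in>succs x. \<sigma> y)))
      = (\<Prod>y\<in>succs x. edge_kernel y (\<sigma> (butlast y)) (\<sigma> y))" .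
  qed
  also have "\<dots> = (\<Prod>y\<in>sphere_at (Suc n). edge_kernel y (\<sigma> (butlast y)) (\<sigma> y))"
    by (rule prod_sphere_Suc[symmetric])
  finally show ?thesis
    by (simp only: weight_def exp_add exp_sum[OF finite_sphere] prod.distrib mult.assoc)
qed

text \<open>Given the inner configuration, the weight is a product of functions of one new spin
  each, so the integral is a product of one-dimensional integrals.\<close>

lemma integral_weight_Suc:
  assumes n: "n \<ge> 1" and h: "boundary_field h" and \<sigma>: "\<sigma> \<in> ball_at n \<rightarrow>\<^sub>E {0..1}"
  shows "(\<integral>\<omega>. weight M h (Suc n) (merge (ball_at n) (sphere_at (Suc n)) (\<sigma>, \<omega>)) \<partial>lambda_on (sphere_at (Suc n)))
    = exp (- cbeta M * hamiltonian M n \<sigma>) *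
      (\<Prod>x\<in>sphere_at n. \<Prod>y\<in>succs x. kernel_op (edge_kernel y) (\<lambda>t. exp (h t y)) (\<sigma> x))"
proof -
  let ?S = "sphere_at (Suc n)"
  have par: "butlast y \<in> ball_at n" "y \<noteq> []" "y \<in> V" "y \<notin> ball_at n" if "y \<in> ?S" for y
    using that butlast_in_V[of y] by (auto simp: sphere_eq ball_eq)
  have "(\<integral>\<omega>. weight M h (Suc n) (merge (ball_at n) ?S (\<sigma>, \<omega>)) \<partial>lambda_on ?S)
    = (\<integral>\<omega>. exp (- cbeta M * hamiltonian M n \<sigma>) *
        (\<Prod>y\<in>?S. edge_kernel y (\<sigma> (butlast y)) (\<omega> y) * exp (h (\<omega> y) y)) \<partial>lambda_on ?S)"
  proof (rule Bochner_Integration.integral_cong[OF refl])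
    fix \<omega> assume "\<omega> \<in> space (lambda_on ?S)"
    then have \<omega>: "\<omega> y \<in> {0..1}" if "y \<in> ?S" for y
      using that by (auto simp: space_PiM space_unit_lborel)
    let ?\<tau> = "merge (ball_at n) ?S (\<sigma>, \<omega>)"
    have \<tau>: "x \<in> ball_at n \<Longrightarrow> ?\<tau> x = \<sigma> x" "x \<in> ?S \<Longrightarrow> ?\<tau> x = \<omega> x" for x
      using par(4) by (auto simp: merge_def)
    have "?\<tau> x \<in> {0..1}" if "x \<in> ball_at (Suc n)" for x
      using that \<tau> \<omega> \<sigma> by (auto simp: ball_Suc(1))
    moreover have "hamiltonian M n ?\<tau> = hamiltonian M n \<sigma>"
      by (rule hamiltonian_cong[OF n \<tau>(1)])
    ultimately show "weight M h (Suc n) ?\<tau> = exp (- cbeta M * hamiltonian M n \<sigma>) *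
        (\<Prod>y\<in>?S. edge_kernel y (\<sigma> (butlast y)) (\<omega> y) * exp (h (\<omega> y) y))"
      using weight_Suc[OF n] \<tau> par by simp
  qed
  also have "\<dots> = exp (- cbeta M * hamiltonian M n \<sigma>) *
      (\<integral>\<omega>. (\<Prod>y\<in>?S. edge_kernel y (\<sigma> (butlast y)) (\<omega> y) * exp (h (\<omega> y) y)) \<partial>lambda_on ?S)"
    by simp
  also have "(\<integral>\<omega>. (\<Prod>y\<in>?S. edge_kernel y (\<sigma> (butlast y)) (\<omega> y) * exp (h (\<omega> y) y)) \<partial>lambda_on ?S)
    = (\<Prod>y\<in>?S. kernel_op (edge_kernel y) (\<lambda>t. exp (h t y)) (\<sigma> (butlast y)))"
    unfolding kernel_op_def
  proof (rule unit_prod.product_integral_prod[OF finite_sphere])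
    fix y assume "y \<in> ?S"
    then show "integrable unit_lborel (\<lambda>u. edge_kernel y (\<sigma> (butlast y)) u * exp (h u y))"
      using par[of y] \<sigma> by (intro pos_kernel.integrable_kernel pos_kernel_edge_kernel bpos_exp_field h) auto
  qed
  also have "\<dots> = (\<Prod>x\<in>sphere_at n. \<Prod>y\<in>succs x. kernel_op (edge_kernel y) (\<lambda>t. exp (h t y)) (\<sigma> x))"
    unfolding prod_sphere_Suc by (intro prod.cong refl) (auto simp: succs_eq sphere_eq)
  finally show ?thesis .
qed

text \<open>Compatibility between levels \<open>n\<close> and \<open>n + 1\<close>, for
  \<open>n\<close> the length of \<open>x\<close>, equates two products over the sphere once the
  common Boltzmann factor is cancelled. Varying only the spin at \<open>x\<close> isolates its
  factor.\<close>

lemma boundary_equation: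
  assumes \<mu>: "splitting_gibbs M h \<mu>" and x: "x \<in> V" "x \<noteq> []"
    and yz: "succs x = {y, z}" "y \<noteq> z" "(y, z) \<in> sless M x"
  shows "(\<lambda>t. exp (h t x)) \<propto>
    (\<lambda>t. kernel_op \<theta>1 (\<lambda>t. exp (h t y)) t * kernel_op \<theta>2 (\<lambda>t. exp (h t z)) t)"
proof -
  define n where "n = length x"
  have n: "n \<ge> 1" and xn: "x \<in> sphere_at n" using x by (auto simp: n_def sphere_eq Suc_le_eq)
  have h: "boundary_field h" and comp: "compatible M h" using \<mu> by (auto simp: splitting_gibbs_def)
  define G where "G x t = (\<Prod>y\<in>succs x. kernel_op (edge_kernel y) (\<lambda>t. exp (h t y)) t)" for x t
  have G_pos: "0 < G w t" if "w \<in> V" "t \<in> {0..1}" for w t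
    unfolding G_def
  proof (rule prod_pos)
    fix y assume "y \<in> succs w"
    then have "cpos (kernel_op (edge_kernel y) (\<lambda>t. exp (h t y)))"
      using that(1) by (intro pos_kernel.cpos_kernel_op pos_kernel_edge_kernel bpos_exp_field h) (auto simp: succs_eq)
    then show "0 < kernel_op (edge_kernel y) (\<lambda>t. exp (h t y)) t"
      using that(2) by (simp add: cpos_def)
  qed
  have Z: "0 < partition_Z M h n" "0 < partition_Z M h (Suc n)"
    using partition_Z_pos[OF \<mu>] n by auto
  have eq: "(\<Prod>w\<in>sphere_at n. G w (\<sigma> w)) / partition_Z M h (Suc n)
    = (\<Prod>w\<in>sphere_at n. exp (h (\<sigma> w) w)) / partition_Z M h n"
    if \<sigma>: "\<sigma> \<in> ball_at n \<rightarrow>\<^sub>E {0..1}" for \<sigma>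
  proof -
    let ?E = "exp (- cbeta M * hamiltonian M n \<sigma>)"
    have "(\<integral>\<omega>. gibbs_density M h (Suc n) (merge (ball_at n) (sphere_at (Suc n)) (\<sigma>, \<omega>))
        \<partial>lambda_on (sphere_at (Suc n))) = gibbs_density M h n \<sigma>"
      using comp[unfolded compatible_def, rule_format, of "Suc n" \<sigma>] n \<sigma> by simp
    then have "?E * (\<Prod>w\<in>sphere_at n. G w (\<sigma> w)) / partition_Z M h (Suc n)
      = ?E * (\<Prod>w\<in>sphere_at n. exp (h (\<sigma> w) w)) / partition_Z M h n"
      unfolding gibbs_density_def integral_divide_zero integral_weight_Suc[OF n h \<sigma>]
      by (simp add: G_def weight_def exp_add exp_diff exp_minus exp_sum[OF finite_sphere] divide_inverse)
    then have "?E * ((\<Prod>w\<in>sphere_at n. G w (\<sigma> w)) / partition_Z M h (Suc n))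
      = ?E * ((\<Prod>w\<in>sphere_at n. exp (h (\<sigma> w) w)) / partition_Z M h n)"
      by (simp only: times_divide_eq_right)
    then show ?thesis by (simp only: mult_cancel_left exp_not_eq_zero simp_thms)
  qed
  let ?R = "sphere_at n - {x}"
  define P where "P = (\<Prod>w\<in>?R. G w 0)"
  define Q where "Q = (\<Prod>w\<in>?R. exp (h 0 w))"
  have PQ: "0 < P" "0 < Q"
    using G_pos by (auto simp: P_def Q_def sphere_eq intro!: prod_pos)
  have "exp (h t x) = (partition_Z M h n * P / (partition_Z M h (Suc n) * Q)) * G x t" if t: "t \<in> {0..1}" for t
  proof -
    \<comment> \<open>All spins but that at \<open>x\<close> are frozen at 0, so the other vertices
      contribute the constants \<open>P\<close> and \<open>Q\<close>.\<close>
    define \<sigma> where "\<sigma> = restrict (\<lambda>w. if w = x then t else 0) (ball_at n)"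
    have "\<sigma> \<in> ball_at n \<rightarrow>\<^sub>E {0..1}" using t by (auto simp: \<sigma>_def)
    moreover have "sphere_at n \<subseteq> ball_at n" by (auto simp: sphere_eq ball_eq)
    then have s: "\<sigma> x = t" "\<And>w. w \<in> ?R \<Longrightarrow> \<sigma> w = 0" using xn by (auto simp: \<sigma>_def)
    then have "(\<Prod>w\<in>sphere_at n. G w (\<sigma> w)) = G x t * P"
      "(\<Prod>w\<in>sphere_at n. exp (h (\<sigma> w) w)) = exp (h t x) * Q"
      unfolding P_def Q_def by (subst prod.remove[OF finite_sphere xn]; simp)+
    ultimately have "G x t * P / partition_Z M h (Suc n) = exp (h t x) * Q / partition_Z M h n"
      using eq by metis
    then show ?thesis using Z PQ by (simp add: field_simps)
  qed
  then have "(\<lambda>t. exp (h t x)) \<propto> G x"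
    using Z PQ by (intro prop_toI[of "partition_Z M h n * P / (partition_Z M h (Suc n) * Q)"]) auto
  moreover have "G x t = kernel_op \<theta>1 (\<lambda>t. exp (h t y)) t * kernel_op \<theta>2 (\<lambda>t. exp (h t z)) t" for t
    using prod_succs[OF x yz, of "\<lambda>k w. kernel_op k (\<lambda>t. exp (h t w)) t"] by (simp add: G_def)
  ultimately show ?thesis by (simp add: prop_to_def)
qed

end


section \<open>Periodic fields\<close>

locale periodic_model = factorized_model \<theta>1 \<theta>2 M + H: normal H G2
  for \<theta>1 \<theta>2 M H +
  fixes h :: "real \<Rightarrow> vertex \<Rightarrow> real" and \<mu> :: "(vertex \<Rightarrow> real) measure"
  assumes finite_index: "finite (rcosets\<^bsub>G2\<^esub> H)"
    and orders_inv: "invariant_orders H M"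
    and gibbs: "splitting_gibbs M h \<mu>"
    and periodic: "periodic_field H h"
begin

text \<open>
  Evaluating the field at a non-root representative of the coset of \<open>x\<close> extends it
  periodically to the root.
\<close>

definition rep :: "vertex \<Rightarrow> vertex" where
  "rep x = (SOME z. z \<in> H #>\<^bsub>G2\<^esub> x \<and> z \<noteq> [])"

definition ext :: "vertex \<Rightarrow> real \<Rightarrow> real" where
  "ext x t = exp (h t (rep x))"

lemma rep:
  assumes "x \<in> V"
  obtains g where "g \<in> H" "rep x = g \<otimes>\<^bsub>G2\<^esub> x" "rep x \<noteq> []" "rep x \<in> V"
proof -
  obtain g where "g \<in> H" "g \<otimes>\<^bsub>G2\<^esub> x \<noteq> []"
    using translate_with_last_letter[OF H.normal_axioms finite_index assms] by metis
  then have "\<exists>z. z \<in> H #>\<^bsub>G2\<^esub> x \<and> z \<noteq> []" by (auto simp: r_coset_def)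
  then have *: "rep x \<in> H #>\<^bsub>G2\<^esub> x \<and> rep x \<noteq> []" unfolding rep_def by (rule someI_ex)
  then show ?thesis using that assms by (auto simp: r_coset_def H.mem_carrier)
qed

text \<open>\<open>rep\<close> depends only on the coset, so this is an exact equality and includes
  the root.\<close>

lemma ext_translate:
  assumes "g \<in> H" "x \<in> V" shows "ext (g \<otimes>\<^bsub>G2\<^esub> x) = ext x"
proof -
  have "g \<otimes>\<^bsub>G2\<^esub> x \<in> H #>\<^bsub>G2\<^esub> x" using assms by (auto simp: r_coset_def)
  then have "H #>\<^bsub>G2\<^esub> x = H #>\<^bsub>G2\<^esub> (g \<otimes>\<^bsub>G2\<^esub> x)"
    by (rule G2.repr_independence[OF _ assms(2) H.subgroup_axioms])
  then show ?thesis by (simp add: ext_def rep_def fun_eq_iff)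
qed

text \<open>Both \<open>x\<close> and its representative avoid the root, as
  \<open>periodic_field\<close> requires.\<close>

lemma ext_eq:
  assumes "x \<in> V" "x \<noteq> []" "t \<in> {0..1}" shows "ext x t = exp (h t x)"
proof -
  obtain g where "g \<in> H" "rep x = g \<otimes>\<^bsub>G2\<^esub> x" "rep x \<noteq> []" using rep[OF assms(1)] by metis
  then show ?thesis using periodic assms by (simp add: ext_def periodic_field_def root_eq)
qed

lemma ext_prop_to: "x \<in> V \<Longrightarrow> x \<noteq> [] \<Longrightarrow> ext x \<propto> (\<lambda>t. exp (h t x))"
  by (rule prop_to_cong) (rule ext_eq)

text \<open>\<open>ext\<close> factors through the finitely many cosets.\<close>

lemma finite_ext: "finite (ext ` V)"
proof -
  let ?E = "\<lambda>C t. exp (h t (SOME z. z \<in> C \<and> z \<noteq> []))"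
  have "ext ` V \<subseteq> ?E ` (rcosets\<^bsub>G2\<^esub> H)"
  proof
    fix y assume "y \<in> ext ` V"
    then obtain x where "x \<in> V" "y = ?E (H #>\<^bsub>G2\<^esub> x)" by (auto simp: ext_def rep_def fun_eq_iff)
    then show "y \<in> ?E ` (rcosets\<^bsub>G2\<^esub> H)" by (auto simp: RCOSETS_def)
  qed
  then show ?thesis using finite_index finite_surj by blast
qed

lemma boundary_field: "boundary_field h"
  using gibbs by (simp add: splitting_gibbs_def)

text \<open>Continuity is gained from the boundary equation at the representative, whose right-hand
  side is a product of kernel integrals.\<close>

lemma ext_cpos:
  assumes "x \<in> V" shows "cpos (ext x)"
proof -
  obtain g where g: "g \<in> H" "rep x = g \<otimes>\<^bsub>G2\<^esub> x" "rep x \<noteq> []" "rep x \<in> V" using rep[OF assms] .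
  obtain y z where yz: "succs (rep x) = {y, z}" "y \<noteq> z" "(y, z) \<in> sless M (rep x)"
    using ordered_succs[OF orders g(4,3)] .
  then have "y \<in> V \<and> y \<noteq> []" "z \<in> V \<and> z \<noteq> []" using succs_eq[OF g(4)] by auto
  then have "bpos (\<lambda>t. exp (h t y))" "bpos (\<lambda>t. exp (h t z))"
    using bpos_exp_field[OF boundary_field] by auto
  then have "cpos (\<lambda>t. exp (h t (rep x)))"
    by (intro cpos_prop_to[OF boundary_equation[OF gibbs g(4,3) yz]] cpos_mult
        K1.cpos_kernel_op K2.cpos_kernel_op)
  then show ?thesis by (simp add: ext_def[abs_def])
qed

text \<open>
  Any neighbour of \<open>x\<close> becomes the parent after a suitable translation by \<open>H\<close>, so that the
  other two become the successors.
\<close>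

lemma ext_law:
  assumes x: "x \<in> V" and yz: "y \<in> nbrs x" "z \<in> nbrs x" "(y, z) \<in> sless M x"
  shows "ext x \<propto> (\<lambda>t. kernel_op \<theta>1 (ext y) t * kernel_op \<theta>2 (ext z) t)"
proof -
  have "irrefl (sless M x)"
    using orders x by (simp add: neighbour_orders_def strict_linear_order_on_def)
  then have ne: "y \<noteq> z" using yz(3) by (auto simp: irrefl_def)
  have V: "y \<in> V" "z \<in> V" using nbrs_subset_V[OF x] yz by auto
  have "\<not> nbrs x \<subseteq> {y, z}"
    using card_nbrs[OF x] ne card_mono[of "{y, z}" "nbrs x"] by auto
  then obtain w where w: "w \<in> nbrs x" "w \<noteq> y" "w \<noteq> z" by auto
  then obtain b where b: "w = x \<otimes>\<^bsub>G2\<^esub> [b]" by (auto simp: nbrs_def)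
  have wV: "w \<in> V" using nbrs_subset_V[OF x] w by auto
  obtain g where g: "g \<in> H" "g \<otimes>\<^bsub>G2\<^esub> x \<noteq> []" "last (g \<otimes>\<^bsub>G2\<^esub> x) = b"
    using translate_with_last_letter[OF H.normal_axioms finite_index x] .
  have gV: "g \<in> V" using g(1) by (rule H.mem_carrier)
  let ?x = "g \<otimes>\<^bsub>G2\<^esub> x" and ?y = "g \<otimes>\<^bsub>G2\<^esub> y" and ?z = "g \<otimes>\<^bsub>G2\<^esub> z"
  have gx: "?x \<in> V" using gV x by simp
  have "g \<otimes>\<^bsub>G2\<^esub> w = ?x \<otimes>\<^bsub>G2\<^esub> [b]"
    using gV x by (simp add: b G2.m_assoc letter_in_V)
  \<comment> \<open>The letter \<open>b\<close> leading from \<open>x\<close> to the third neighbour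
    \<open>w\<close> cancels the last letter of the translate.\<close>
  then have "butlast ?x = g \<otimes>\<^bsub>G2\<^esub> w" using g(2,3) gx by (simp add: mult_letter)
  moreover have "?y \<in> nbrs ?x" "?z \<in> nbrs ?x"
    using nbrs_translate[OF gV x] yz by auto
  moreover have "?y \<noteq> g \<otimes>\<^bsub>G2\<^esub> w" "?z \<noteq> g \<otimes>\<^bsub>G2\<^esub> w" "?y \<noteq> ?z"
    using w ne gV wV V by auto
  ultimately have "{?y, ?z} \<subseteq> succs ?x" "?y \<noteq> ?z"
    using nbrs_eq_insert_succs[OF gx g(2)] by auto
  moreover from this have "{?y, ?z} = succs ?x"
    using card_succs[OF gx g(2)] by (intro card_subset_eq finite_succs gx) auto
  moreover have "(?y, ?z) \<in> sless M ?x"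
    using orders_inv g(1) x yz unfolding invariant_orders_def by blast
  ultimately have eq: "(\<lambda>t. exp (h t ?x)) \<propto>
      (\<lambda>t. kernel_op \<theta>1 (\<lambda>t. exp (h t ?y)) t * kernel_op \<theta>2 (\<lambda>t. exp (h t ?z)) t)"
    by (intro boundary_equation[OF gibbs gx g(2)]) auto
  have "?y \<in> V \<and> ?y \<noteq> []" "?z \<in> V \<and> ?z \<noteq> []"
    using \<open>{?y, ?z} \<subseteq> succs ?x\<close> succs_eq[OF gx] by auto
  then have "(\<lambda>t. exp (h t ?y)) \<propto> ext ?y" "(\<lambda>t. exp (h t ?z)) \<propto> ext ?z"
    using ext_prop_to prop_to_sym by blast+
  from prop_to_mult[OF K1.kernel_op_prop_to[OF this(1)] K2.kernel_op_prop_to[OF this(2)]]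
  have "ext ?x \<propto> (\<lambda>t. kernel_op \<theta>1 (ext ?y) t * kernel_op \<theta>2 (ext ?z) t)"
    by (rule prop_to_trans[OF prop_to_trans[OF ext_prop_to[OF gx g(2)] eq]])
  then show ?thesis using ext_translate[OF g(1)] x V by simp
qed

sublocale ext: boundary_law \<theta>1 \<theta>2 M ext
  by unfold_locales (use orders ext_cpos finite_ext ext_law in auto)

end


section \<open>Normalised fields\<close>

text \<open>Fixes the free additive constant, turning proportional exponentials into the exact
  equality that \<open>periodic_field\<close> demands.\<close>

definition normalised :: "(real \<Rightarrow> vertex \<Rightarrow> real) \<Rightarrow> real \<Rightarrow> vertex \<Rightarrow> real" where
  "normalised h t x = h t x - h 0 x"

text \<open>The shift multiplies the weight by a factor independent of the configuration, which the
  partition function absorbs.\<close>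

lemma gibbs_density_normalised: "gibbs_density M (normalised h) n \<sigma> = gibbs_density M h n \<sigma>"
proof -
  have "weight M (normalised h) n \<sigma> = exp (- (\<Sum>x\<in>sphere_at n. h 0 x)) * weight M h n \<sigma>" for \<sigma>
    by (simp add: weight_def normalised_def sum_subtractf flip: exp_add)
  then show ?thesis by (simp add: gibbs_density_def partition_Z_def)
qed

lemma boundary_field_normalised:
  assumes "boundary_field h" shows "boundary_field (normalised h)"
  unfolding boundary_field_def
proof (intro ballI conjI)
  fix x assume "x \<in> V - {root}"
  then have h: "(\<lambda>t. h t x) \<in> borel_measurable (restrict_space borel {0..1})"
    "bounded ((\<lambda>t. h t x) ` {0..1})" using assms by (auto simp: boundary_field_def)
  show "(\<lambda>t. normalised h t x) \<in> borel_measurable (restrict_space borel {0..1})"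
    unfolding normalised_def using h(1) by simp
  have "(\<lambda>t. normalised h t x) ` {0..1} = (+) (- h 0 x) ` (\<lambda>t. h t x) ` {0..1}"
    by (simp add: normalised_def image_image)
  then show "bounded ((\<lambda>t. normalised h t x) ` {0..1})"
    by (simp only: bounded_translation[OF h(2)])
qed

lemma splitting_gibbs_normalised:
  "splitting_gibbs M h \<mu> \<Longrightarrow> splitting_gibbs M (normalised h) \<mu>"
  by (simp add: splitting_gibbs_def compatible_def gibbs_density_normalised boundary_field_normalised)

lemma normalised_eq:
  assumes "(\<lambda>t. exp (h t x)) \<propto> (\<lambda>t. exp (h t y))" "t \<in> {0..1}"
  shows "normalised h t x = normalised h t y"
proof -
  obtain c where c: "c > 0" "\<And>t. t \<in> {0..1} \<Longrightarrow> exp (h t x) = c * exp (h t y)"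
    using assms by (auto simp: prop_to_def)
  have "h t x = ln c + h t y" if "t \<in> {0..1}" for t
  proof -
    have "exp (h t x) = exp (ln c + h t y)" using c that by (simp add: exp_add)
    then show ?thesis by simp
  qed
  then show ?thesis using assms(2) by (simp add: normalised_def)
qed

text \<open>Each use of \<open>gcons\<close> adds or removes exactly one letter.\<close>

lemma even_length_mult: "even (length (x \<otimes>\<^bsub>G2\<^esub> y)) \<longleftrightarrow> even (length x + length y)"
proof -
  have gcons: "even (length (gcons a w)) \<longleftrightarrow> odd (length w)" for a w
    by (cases w) auto
  show ?thesis unfolding mult_G2 by (induction x) (auto simp: gcons)
qed

lemma (in periodic_model) periodic_G2_even: "periodic_gibbs M G2_even \<mu>"
proof -
  have "periodic_field G2_even (normalised h)"
    unfolding periodic_field_def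
  proof (intro ballI impI)
    fix x y t assume x: "x \<in> V" "x \<noteq> root" and y: "y \<in> G2_even" "y \<otimes>\<^bsub>G2\<^esub> x \<noteq> root"
      and t: "t \<in> {0..1::real}"
    have V: "y \<otimes>\<^bsub>G2\<^esub> x \<in> V" and par: "even (length (y \<otimes>\<^bsub>G2\<^esub> x)) = even (length x)"
      using x y by (auto simp: G2_even_def even_length_mult)
    have "(\<lambda>t. exp (h t (y \<otimes>\<^bsub>G2\<^esub> x))) \<propto> (\<lambda>t. exp (h t x))"
      using x y V prop_to_trans[OF prop_to_trans[OF prop_to_sym[OF ext_prop_to]
          ext.prop_to_same_parity[OF V x(1) par]] ext_prop_to] by (simp add: root_eq)
    then show "normalised h t (y \<otimes>\<^bsub>G2\<^esub> x) = normalised h t x"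
      using t by (rule normalised_eq)
  qed
  then show ?thesis
    using splitting_gibbs_normalised[OF gibbs] by (auto simp: periodic_gibbs_def)
qed

theorem theorem4p4:
  fixes M :: model
    and \<theta>1 \<theta>2 :: "real \<Rightarrow> real \<Rightarrow> real"
    and Gs :: "vertex set"
    and \<mu> :: "(vertex \<Rightarrow> real) measure"
  assumes xi1_meas: "(\<lambda>(t, u, v). xi1 M t u v)
            \<in> borel_measurable (restrict_space borel ({0..1} \<times> {0..1} \<times> {0..1}))"
    and xi1_bdd: "bounded ((\<lambda>(t, u, v). xi1 M t u v) ` ({0..1} \<times> {0..1} \<times> {0..1}))"
    and xi2_meas: "(\<lambda>(u, v). xi2 M u v) \<in> borel_measurable (restrict_space borel ({0..1} \<times> {0..1}))"
    and xi2_bdd: "bounded ((\<lambda>(u, v). xi2 M u v) ` ({0..1} \<times> {0..1}))"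
    and xi3_meas: "(\<lambda>(t, u). xi3 M t u) \<in> borel_measurable (restrict_space borel ({0..1} \<times> {0..1}))"
    and xi3_bdd: "bounded ((\<lambda>(t, u). xi3 M t u) ` ({0..1} \<times> {0..1}))"
    and beta_pos: "cbeta M > 0"
    and couplings: "(cJ3 M)\<^sup>2 + (cJ1 M)\<^sup>2 + (cJ M)\<^sup>2 + (calpha M)\<^sup>2 \<noteq> 0"
    and orders: "neighbour_orders M"
    and theta1_cont: "continuous_on ({0..1} \<times> {0..1}) (\<lambda>(t, u). \<theta>1 t u)"
    and theta2_cont: "continuous_on ({0..1} \<times> {0..1}) (\<lambda>(t, v). \<theta>2 t v)"
    and theta1_pos: "\<And>t u. t \<in> {0..1} \<Longrightarrow> u \<in> {0..1} \<Longrightarrow> \<theta>1 t u > 0"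
    and theta2_pos: "\<And>t v. t \<in> {0..1} \<Longrightarrow> v \<in> {0..1} \<Longrightarrow> \<theta>2 t v > 0"
    and K_factor: "\<And>t u v. t \<in> {0..1} \<Longrightarrow> u \<in> {0..1} \<Longrightarrow> v \<in> {0..1} \<Longrightarrow>
            kernel_K M t u v = \<theta>1 t u * \<theta>2 t v"
    and normal: "normal Gs G2"
    and finite_index: "finite (rcosets\<^bsub>G2\<^esub> Gs)"
    and orders_inv: "invariant_orders Gs M"
    and periodic: "periodic_gibbs M Gs \<mu>"
  shows "translation_invariant_gibbs M \<mu> \<or> periodic_gibbs M G2_even \<mu>"
proof -
  obtain h where h: "splitting_gibbs M h \<mu>" "periodic_field Gs h"
    using periodic by (auto simp: periodic_gibbs_def)
  have "periodic_model \<theta>1 \<theta>2 M Gs h \<mu>"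
    by (intro periodic_model.intro periodic_model_axioms.intro factorized_model.intro
        factorized_model_axioms.intro pos_kernel.intro)
      (fact theta1_cont theta2_cont theta1_pos theta2_pos orders K_factor normal finite_index
        orders_inv h)+
  \<comment> \<open>The second alternative holds in every case; translation invariance is a special
    case of it.\<close>
  then show ?thesis by (intro disjI2 periodic_model.periodic_G2_even)
qed

end
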